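(* Fix $0<\delta<\tfrac12$, $0<\lambda\le1\le\Lambda$, an open set $\Omega\subset\mathbb H^n$ and $\omega$ as in the context; let $\eta=2\sqrt{\Lambda/\lambda}+1$. There exist $\epsilon_0\in(0,1)$ depending only on $\lambda,\Lambda,Q,\delta,\omega$, and $\epsilon\in(0,1)$ depending only on $Q,\lambda,\Lambda$ (and the fixed $\delta$), such that: for all $z_0\in\Omega$ and $0<r\le\epsilon_0$ with $B_{\eta r}(z_0)\subseteq\Omega$, for every symplectic $A\in M_n(\lambda,\Lambda,\Omega)\cap C(\Omega,\omega)$, and for every $u\in C^2(B_{\eta r}(z_0))$ with (i) $u\ge0$ in $B_{\eta r}(z_0)$, (ii) $\mathcal L_Au\le0$ in $B_{\eta r}(z_0)$, (iii) $\inf_{B_{r/2}(z_0)}u<\tfrac12$, one has $$\big|\{z\in B_r(z_0):u(z)<1\}\big|\ge\epsilon\,|B_r(z_0)|.$$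
   Context: Points $z=(x,t)\in\mathbb R^{2n+1}$; $J=\begin{pmatrix}0&-\mathbb I_n\\ \mathbb I_n&0\end{pmatrix}$, $Q=2n+2$. $\mathbb H^n$: $(x,t)\circ(\xi,\tau)=(x+\xi,t+\tau+2\langle Jx,\xi\rangle)$, $(x,t)^{-1}=(-x,-t)$; $\rho(x,t)=(|x|^4+t^2)^{1/4}$, $d(z,\zeta)=\rho(z^{-1}\circ\zeta)$, $B_R(z)=\{\zeta:d(z,\zeta)<R\}$; $|\cdot|$ is Lebesgue measure. $X_i=\partial_{x_i}+2(Jx)_i\partial_t$, $D^2_{\mathbb H}u=(\tfrac12(X_iX_j+X_jX_i)u)_{i,j=1}^{2n}$, $\mathcal L_Au(z)=\mathrm{tr}(A(z)D^2_{\mathbb H}u(z))$. $M_n(\lambda,\Lambda,\Omega)$: symmetric matrix functions on $\Omega$ with $\det A(z)=1$ and $\lambda\mathbb I\le A(z)\le\Lambda\mathbb I$; symplectic means $A(z)^{-1}=J^tA(z)J$ for all $z$. $\omega:[0,1)\to[0,1)$ nondecreasing with $\omega(0)=\lim_{s\to0^+}\omega(s)=0$; $C(\Omega,\omega)$: continuous $A$ with $\sup_{z\in B_\epsilon(z_0)\cap\Omega}\|A(z)-A(z_0)\|\le\omega(\epsilon)$ for all $z_0\in\Omega$, $0<\epsilon<1$ ($\|\cdot\|$ operator norm). *)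

theory Defs
  imports "HOL-Analysis.Analysis"
begin

text \<open>Points of the Heisenberg group H^n are pairs (x,t) with x in R^{2n} and t real.
  R^{2n} is modelled as real^('n + 'n): index Inl k is coordinate k, index Inr k is
  coordinate n+k (k = 1..n, n = CARD('n)).\<close>

type_synonym 'n hpoint = "(real^('n + 'n)) \<times> real"

definition Jmat :: "real^('n::finite + 'n)^('n + 'n)" where
  "Jmat = (\<chi> i j. case (i, j) of
      (Inl a, Inr b) \<Rightarrow> (if a = b then -1 else 0)
    | (Inr a, Inl b) \<Rightarrow> (if a = b then 1 else 0)
    | _ \<Rightarrow> 0)"

definition hmul :: "'n::finite hpoint \<Rightarrow> 'n hpoint \<Rightarrow> 'n hpoint" where
  "hmul z w = (fst z + fst w, snd z + snd w + 2 * ((Jmat *v fst z) \<bullet> fst w))"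

definition hinv :: "'n::finite hpoint \<Rightarrow> 'n hpoint" where
  "hinv z = (- fst z, - snd z)"

definition hgauge :: "'n::finite hpoint \<Rightarrow> real" where
  "hgauge z = (norm (fst z) ^ 4 + (snd z)\<^sup>2) powr (1/4)"

definition hdist :: "'n::finite hpoint \<Rightarrow> 'n hpoint \<Rightarrow> real" where
  "hdist z w = hgauge (hmul (hinv z) w)"

definition hball :: "'n::finite hpoint \<Rightarrow> real \<Rightarrow> 'n hpoint set" where
  "hball z R = {w. hdist z w < R}"

definition hfield :: "('n::finite + 'n) \<Rightarrow> 'n hpoint \<Rightarrow> 'n hpoint" where
  "hfield i z = (axis i 1, 2 * (Jmat *v fst z) $ i)"

definition Xd :: "('n::finite + 'n) \<Rightarrow> ('n hpoint \<Rightarrow> real) \<Rightarrow> 'n hpoint \<Rightarrow> real" where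
  "Xd i f z = frechet_derivative f (at z) (hfield i z)"

definition hhess :: "('n::finite hpoint \<Rightarrow> real) \<Rightarrow> 'n hpoint \<Rightarrow> real^('n + 'n)^('n + 'n)" where
  "hhess u z = (\<chi> i j. (Xd i (Xd j u) z + Xd j (Xd i u) z) / 2)"

definition LA :: "('n::finite hpoint \<Rightarrow> real^('n + 'n)^('n + 'n)) \<Rightarrow> ('n hpoint \<Rightarrow> real) \<Rightarrow> 'n hpoint \<Rightarrow> real" where
  "LA A u z = trace (A z ** hhess u z)"

definition C2_on :: "'n::finite hpoint set \<Rightarrow> ('n hpoint \<Rightarrow> real) \<Rightarrow> bool" where
  "C2_on S u \<longleftrightarrow> (\<exists>Du :: 'n hpoint \<Rightarrow> ('n hpoint \<Rightarrow>\<^sub>L real).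
     \<exists>D2u :: 'n hpoint \<Rightarrow> ('n hpoint \<Rightarrow>\<^sub>L ('n hpoint \<Rightarrow>\<^sub>L real)).
       (\<forall>z\<in>S. (u has_derivative blinfun_apply (Du z)) (at z)) \<and>
       (\<forall>z\<in>S. (Du has_derivative blinfun_apply (D2u z)) (at z)) \<and>
       continuous_on S D2u)"

definition Mclass :: "real \<Rightarrow> real \<Rightarrow> 'n::finite hpoint set \<Rightarrow> ('n hpoint \<Rightarrow> real^('n + 'n)^('n + 'n)) \<Rightarrow> bool" where
  "Mclass lam Lam \<Omega> A \<longleftrightarrow> (\<forall>z\<in>\<Omega>. transpose (A z) = A z \<and> det (A z) = 1 \<and>
     (\<forall>\<xi>. lam * (\<xi> \<bullet> \<xi>) \<le> \<xi> \<bullet> (A z *v \<xi>) \<and> \<xi> \<bullet> (A z *v \<xi>) \<le> Lam * (\<xi> \<bullet> \<xi>)))"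

definition symplectic_on :: "'n::finite hpoint set \<Rightarrow> ('n hpoint \<Rightarrow> real^('n + 'n)^('n + 'n)) \<Rightarrow> bool" where
  "symplectic_on \<Omega> A \<longleftrightarrow> (\<forall>z\<in>\<Omega>. matrix_inv (A z) = transpose Jmat ** A z ** Jmat)"

definition modulus :: "(real \<Rightarrow> real) \<Rightarrow> bool" where
  "modulus \<omega> \<longleftrightarrow> (\<forall>s\<in>{0..<1}. \<omega> s \<in> {0..<1}) \<and> mono_on {0..<1} \<omega> \<and> \<omega> 0 = 0 \<and>
     (\<omega> \<longlongrightarrow> 0) (at_right 0)"

definition Cclass :: "'n::finite hpoint set \<Rightarrow> (real \<Rightarrow> real) \<Rightarrow> ('n hpoint \<Rightarrow> real^('n + 'n)^('n + 'n)) \<Rightarrow> bool" where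
  "Cclass \<Omega> \<omega> A \<longleftrightarrow> continuous_on \<Omega> A \<and>
     (\<forall>z0\<in>\<Omega>. \<forall>e. 0 < e \<and> e < 1 \<longrightarrow>
        (\<forall>z\<in>hball z0 e \<inter> \<Omega>. onorm (\<lambda>v. (A z - A z0) *v v) \<le> \<omega> e))"

end

theory Submission
  imports Defs
begin

text \<open>Freeze \<open>A\<^sub>0 = A(z\<^sub>0)\<close>. Since \<open>A\<^sub>0\<close> is symplectic, \<open>P = A\<^sub>0\<^sup>-\<^sup>1 = J\<^sup>t A\<^sub>0 J\<close>, and with
  \<open>q = x \<bullet> Px\<close>, \<open>f = q\<^sup>2 + t\<^sup>2\<close> the kernel \<open>k = f\<close> to the power \<open>-(Q-1)/4\<close> satisfies
  \<open>L\<^bsub>A\<^sub>0\<^esub> k = (Q-1) q k / f\<close> off its pole. All second horizontal derivatives of \<open>k\<close> are bounded by multiples of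
  \<open>q k / f\<close>, so \<open>k\<close> remains \<open>L\<^sub>A\<close>-subharmonic when \<open>A\<close> is close to \<open>A\<^sub>0\<close>, i.e. for small \<open>r\<close>.

  Let \<open>u(z\<^sub>1) < 1/2\<close> with \<open>z\<^sub>1 \<in> B\<^bsub>r/2\<^esub>(z\<^sub>0)\<close> and let \<open>N \<subseteq> B\<^sub>r(z\<^sub>0)\<close> be the ball of the gauge
  \<open>f\<close> around \<open>z\<^sub>1\<close> of radius \<open>s\<close> comparable to \<open>r\<close>. The potential \<open>V(z)\<close> is the integral of
  \<open>k(\<zeta>\<^sup>-\<^sup>1 z)\<close> over the poles \<open>\<zeta>\<close> in \<open>H = N \<inter> {u \<ge> 1}\<close>; it is \<open>L\<^sub>A\<close>-subharmonic on \<open>{u < 1}\<close>. By the bathtub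
  principle \<open>V \<le> M\<close>, where \<open>M\<close> is the integral of \<open>k\<close> over the gauge ball of radius \<open>s\<close>; moreover
  \<open>V \<le> M/2\<close> far from \<open>z\<^sub>0\<close>. The maximum principle on \<open>{u < 1}\<close> gives \<open>u \<ge> 2V/M - 1\<close>. If \<open>{u < 1}\<close> had small measure in \<open>B\<^sub>r(z\<^sub>0)\<close>, then \<open>V(z\<^sub>1)\<close> would be
  at least \<open>3M/4\<close>, contradicting \<open>u(z\<^sub>1) < 1/2\<close>.\<close>

section \<open>Heisenberg group and gauge\<close>

lemma sum_UNIV_Plus:
  fixes g :: "'a::finite + 'b::finite \<Rightarrow> 'c::comm_monoid_add"
  shows "(\<Sum>i\<in>UNIV. g i) = (\<Sum>a\<in>UNIV. g (Inl a)) + (\<Sum>b\<in>UNIV. g (Inr b))"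
  unfolding UNIV_Plus_UNIV[symmetric] by (subst sum.Plus) (simp_all add: comp_def)

lemma matrix_vector_mult_minus: "A *v (- x) = - (A *v (x::real^'n::finite))"
  by (rule linear_neg[OF matrix_vector_mul_linear])

lemma Jmat_Inl: "(Jmat *v x) $ Inl a = - x $ Inr a"
  by (simp add: Jmat_def matrix_vector_mult_def sum_UNIV_Plus if_distrib[of "\<lambda>c. c * _"] cong: if_cong)

lemma Jmat_Inr: "(Jmat *v x) $ Inr a = x $ Inl a"
  by (simp add: Jmat_def matrix_vector_mult_def sum_UNIV_Plus if_distrib[of "\<lambda>c. c * _"] cong: if_cong)

lemma inner_Jmat: "(Jmat *v x) \<bullet> y = - (x \<bullet> (Jmat *v y))"
  by (simp add: inner_vec_def sum_UNIV_Plus Jmat_Inl Jmat_Inr sum_negf)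

lemma inner_Jmat_self: "(Jmat *v x) \<bullet> x = 0"
  using inner_Jmat[of x x] by (simp add: inner_commute)

lemma inner_Jmat_Jmat: "(Jmat *v x) \<bullet> (Jmat *v y) = x \<bullet> y"
  by (simp add: inner_vec_def sum_UNIV_Plus Jmat_Inl Jmat_Inr)

text \<open>Bessel's inequality for \<open>x\<close> and \<open>Jmat *v x\<close>, which are
  orthogonal and of equal length.\<close>

lemma inner_Jmat_sum_le:
  "(x \<bullet> y)\<^sup>2 + ((Jmat *v x) \<bullet> y)\<^sup>2 \<le> (norm x)\<^sup>2 * (norm y)\<^sup>2"
proof -
  let ?j = "Jmat *v x" and ?c = "x \<bullet> y" and ?d = "(Jmat *v x) \<bullet> y"
  \<comment> \<open>Up to the factor \<open>|x|^2\<close>, this is the orthogonal projection of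
    \<open>y\<close> onto the span of \<open>x\<close> and \<open>Jmat *v x\<close>.\<close>
  define v where "v = ?c *\<^sub>R x + ?d *\<^sub>R ?j"
  have vv: "v \<bullet> v = (?c\<^sup>2 + ?d\<^sup>2) * (norm x)\<^sup>2"
    by (simp add: v_def inner_Jmat_self inner_Jmat_Jmat inner_commute[of x ?j]
        power2_norm_eq_inner[of x] power2_eq_square[of ?c] power2_eq_square[of ?d] algebra_simps)
  have vy: "v \<bullet> y = ?c\<^sup>2 + ?d\<^sup>2"
    by (simp add: v_def inner_add_left power2_eq_square)
  have "(v \<bullet> y)\<^sup>2 \<le> (v \<bullet> v) * (y \<bullet> y)" by (rule Cauchy_Schwarz_ineq)
  then have *: "(?c\<^sup>2 + ?d\<^sup>2) * (?c\<^sup>2 + ?d\<^sup>2) \<le> (?c\<^sup>2 + ?d\<^sup>2) * ((norm x)\<^sup>2 * (norm y)\<^sup>2)"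
    by (simp add: vv vy power2_norm_eq_inner[of y] power2_eq_square[of "_ + _"] mult.assoc)
  show ?thesis
  proof (cases "?c\<^sup>2 + ?d\<^sup>2 = 0")
    case True then show ?thesis by simp
  next
    case False
    then have "?c\<^sup>2 + ?d\<^sup>2 > 0" by (simp add: less_le)
    with * show ?thesis by (simp only: mult_le_cancel_left_pos)
  qed
qed

section \<open>The gauge and its triangle inequality\<close>

lemma hgauge_nonneg: "0 \<le> hgauge z"
  by (simp add: hgauge_def)

lemma hgauge_pow4: "hgauge z ^ 4 = norm (fst z) ^ 4 + (snd z)\<^sup>2"
  by (simp add: hgauge_def flip: root_powr_inverse[of 4, simplified])

lemma hgauge_sq: "(hgauge z)\<^sup>2 = cmod (Complex ((norm (fst z))\<^sup>2) (snd z))"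
  unfolding cmod_def by (intro real_sqrt_unique[symmetric]) (simp_all add: hgauge_pow4)

lemma norm_fst_le_hgauge: "norm (fst w) \<le> hgauge w"
proof -
  have "norm (fst w) ^ 4 \<le> hgauge w ^ 4" by (simp add: hgauge_pow4)
  then show ?thesis by (rule power_mono_iff[THEN iffD1, rotated -1]) (simp_all add: hgauge_nonneg)
qed

lemma hgauge_hinv: "hgauge (hinv z) = hgauge z"
  by (simp add: hgauge_def hinv_def)

text \<open>Cygan's inequality: \<open>\<rho>\<^sup>2\<close> is the modulus of the complex number \<open>|x|\<^sup>2 + i t\<close>, which under
  the group law changes by \<open>2 (x \<bullet> \<xi> + i Jx \<bullet> \<xi>)\<close>, of modulus at most \<open>2 |x| |\<xi>|\<close>.\<close>

lemma hgauge_hmul_le: "hgauge (hmul z w) \<le> hgauge z + hgauge w"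
proof -
  define x y where "x = fst z" and "y = fst w"
  have n: "norm x \<le> hgauge z" "norm y \<le> hgauge w"
    by (simp_all add: x_def y_def norm_fst_le_hgauge)
  have eq: "Complex ((norm (fst (hmul z w)))\<^sup>2) (snd (hmul z w)) =
     Complex ((norm x)\<^sup>2) (snd z) + Complex ((norm y)\<^sup>2) (snd w)
     + 2 * Complex (x \<bullet> y) ((Jmat *v x) \<bullet> y)"
    by (simp add: complex_eq_iff hmul_def x_def y_def power2_norm_eq_inner inner_add_left inner_add_right
       inner_commute)
  have "cmod (Complex (x \<bullet> y) ((Jmat *v x) \<bullet> y)) \<le> norm x * norm y"
    using inner_Jmat_sum_le[of x y] unfolding cmod_def
    by (intro real_le_lsqrt) (simp_all add: power_mult_distrib)
  also have "\<dots> \<le> hgauge z * hgauge w" by (intro mult_mono n) (simp_all add: hgauge_nonneg)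
  finally have c: "cmod (2 * Complex (x \<bullet> y) ((Jmat *v x) \<bullet> y)) \<le> 2 * (hgauge z * hgauge w)"
    by (simp add: norm_mult)
  have "(hgauge (hmul z w))\<^sup>2 \<le> (hgauge z)\<^sup>2 + (hgauge w)\<^sup>2 + 2 * (hgauge z * hgauge w)"
    unfolding hgauge_sq eq
    by (intro norm_triangle_le order.trans[OF add_right_mono[OF norm_triangle_ineq]] add_mono)
       (use c in \<open>simp_all add: hgauge_sq x_def y_def\<close>)
  also have "\<dots> = (hgauge z + hgauge w)\<^sup>2" by (simp add: power2_sum)
  finally show ?thesis by (rule power2_le_imp_le) (simp add: hgauge_nonneg)
qed

section \<open>Group identities and the left-invariant distance\<close>

lemma hmul_assoc: "hmul (hmul a b) c = hmul a (hmul b c)"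
  by (simp add: hmul_def matrix_vector_right_distrib inner_add_left inner_add_right algebra_simps)

lemma hmul_hinv_left: "hmul (hinv a) (hmul a b) = b"
  by (simp add: hmul_def hinv_def prod_eq_iff inner_add_right inner_Jmat_self matrix_vector_mult_minus algebra_simps)
 
lemma hmul_hinv_cancel: "hmul a (hmul (hinv a) b) = b"
  by (simp add: hmul_def hinv_def prod_eq_iff inner_add_right inner_Jmat_self matrix_vector_mult_minus algebra_simps)

lemma hinv_hmul_hinv: "hinv (hmul (hinv a) b) = hmul (hinv b) a"
  using inner_Jmat[of "fst a" "fst b"]
  by (simp add: hmul_def hinv_def matrix_vector_mult_minus inner_commute)

lemma hdist_commute: "hdist a b = hdist b a"
  by (metis hdist_def hgauge_hinv hinv_hmul_hinv)

lemma hdist_triangle: "hdist a c \<le> hdist a b + hdist b c"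
proof -
  have "hmul (hinv a) c = hmul (hmul (hinv a) b) (hmul (hinv b) c)"
    by (simp add: hmul_assoc hmul_hinv_cancel)
  then show ?thesis unfolding hdist_def by (metis hgauge_hmul_le)
qed

section \<open>Continuity and compactness of closed balls\<close>

lemma continuous_on_mult_vec [continuous_intros]:
  "continuous_on S g \<Longrightarrow> continuous_on S (\<lambda>x. (P::real^'m::finite^'n::finite) *v g x)"
  by (rule bounded_linear.continuous_on[OF matrix_vector_mul_bounded_linear])

lemma continuous_on_hmul [continuous_intros]:
  assumes "continuous_on S g" "continuous_on S h"
  shows "continuous_on S (\<lambda>x. hmul (g x) (h x))"
  unfolding hmul_def by (intro continuous_intros assms)

lemma continuous_on_hinv [continuous_intros]:
  assumes "continuous_on S g"
  shows "continuous_on S (\<lambda>x. hinv (g x))"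
  unfolding hinv_def by (intro continuous_intros assms)

lemma hgauge_eq_root: "hgauge z = root 4 (norm (fst z) ^ 4 + (snd z)\<^sup>2)"
  by (simp add: hgauge_def root_powr_inverse[of 4, simplified])

lemma continuous_on_hgauge [continuous_intros]:
  assumes "continuous_on S g"
  shows "continuous_on S (\<lambda>x. hgauge (g x))"
  unfolding hgauge_eq_root by (intro continuous_intros assms)

lemma continuous_on_hdist [continuous_intros]:
  assumes "continuous_on S g" "continuous_on S h"
  shows "continuous_on S (\<lambda>x. hdist (g x) (h x))"
  unfolding hdist_def by (intro continuous_intros assms)

lemma open_hball: "open (hball z R)"
  unfolding hball_def by (intro open_Collect_less continuous_intros)

lemma abs_snd_le_hgauge: "\<bar>snd w\<bar> \<le> (hgauge w)\<^sup>2"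
proof -
  have "\<bar>snd w\<bar>\<^sup>2 \<le> hgauge w ^ 4" by (simp add: hgauge_pow4)
  then have "\<bar>snd w\<bar>\<^sup>2 \<le> ((hgauge w)\<^sup>2)\<^sup>2" by simp
  then show ?thesis by (rule power2_le_imp_le) simp
qed

lemma hgauge_eq_0_iff: "hgauge w = 0 \<longleftrightarrow> w = 0"
proof
  assume 0: "hgauge w = 0"
  then have "norm (fst w) \<le> 0" using norm_fst_le_hgauge[of w] by linarith
  moreover have "\<bar>snd w\<bar> \<le> 0" using abs_snd_le_hgauge[of w] 0 by simp
  ultimately show "w = 0" by (intro prod_eqI) simp_all
qed (simp add: hgauge_eq_root)

lemma compact_hgauge_le: "compact {w::'n::finite hpoint. hgauge w \<le> R}"
proof -
  have "closed {w::'n hpoint. hgauge w \<le> R}" by (intro closed_Collect_le continuous_intros)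
  moreover have "{w::'n hpoint. hgauge w \<le> R} \<subseteq> cball 0 R \<times> cball 0 (R\<^sup>2)"
  proof
    fix w :: "'n hpoint" assume "w \<in> {w. hgauge w \<le> R}"
    then have "hgauge w \<le> R" by simp
    moreover from this have "(hgauge w)\<^sup>2 \<le> R\<^sup>2" by (intro power_mono) (simp_all add: hgauge_nonneg)
    ultimately show "w \<in> cball 0 R \<times> cball 0 (R\<^sup>2)"
      using norm_fst_le_hgauge[of w] abs_snd_le_hgauge[of w] by (simp add: mem_Times_iff)
  qed
  ultimately show ?thesis
    unfolding compact_eq_bounded_closed
    by (simp add: bounded_subset[OF bounded_Times[OF bounded_cball bounded_cball]])
qed

text \<open>Left translation by \<open>z\<close> is continuous and carries the closed gauge ball at
  the origin onto this set.\<close>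

lemma compact_hdist_le: "compact {w::'n::finite hpoint. hdist z w \<le> R}"
proof -
  have "{w. hdist z w \<le> R} = hmul z ` {w. hgauge w \<le> R}"
  proof (intro set_eqI iffI)
    fix w assume "w \<in> {w. hdist z w \<le> R}"
    then show "w \<in> hmul z ` {w. hgauge w \<le> R}"
      by (intro image_eqI[of _ _ "hmul (hinv z) w"]) (simp_all add: hdist_def hmul_hinv_cancel)
  next
    fix w assume "w \<in> hmul z ` {w. hgauge w \<le> R}"
    then obtain v where "w = hmul z v" "hgauge v \<le> R" by blast
    then show "w \<in> {w. hdist z w \<le> R}" by (simp add: hdist_def hmul_hinv_left)
  qed
  moreover have "continuous_on {w. hgauge w \<le> R} (hmul z)" by (intro continuous_intros)
  ultimately show ?thesis using compact_continuous_image compact_hgauge_le by metis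
qed

section \<open>Lebesgue measure on the Heisenberg group\<close>

lemma nn_integral_lborel_affine:
  fixes a :: "'a::euclidean_space"
  assumes [measurable]: "g \<in> borel_measurable borel" and c: "c \<noteq> 0"
  shows "ennreal (\<bar>c\<bar> ^ DIM('a)) * (\<integral>\<^sup>+x. g (a + c *\<^sub>R x) \<partial>lborel) = (\<integral>\<^sup>+x. g x \<partial>lborel)"
proof -
  have "(\<integral>\<^sup>+x. g x \<partial>lborel) =
    (\<integral>\<^sup>+x. g x \<partial>density (distr lborel borel (\<lambda>x. a + c *\<^sub>R x)) (\<lambda>_. ennreal (\<bar>c\<bar> ^ DIM('a))))"
    using lborel_affine[OF c, of a] by simp
  also have "\<dots> = ennreal (\<bar>c\<bar> ^ DIM('a)) * (\<integral>\<^sup>+x. g (a + c *\<^sub>R x) \<partial>lborel)"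
    by (simp add: nn_integral_density nn_integral_distr nn_integral_cmult)
  finally show ?thesis ..
qed

text \<open>The anisotropic dilations of the group, under which \<open>hgauge\<close> is homogeneous
  of degree one.\<close>

definition hdil :: "real \<Rightarrow> 'n::finite hpoint \<Rightarrow> 'n hpoint" where
  "hdil c w = (c *\<^sub>R fst w, c\<^sup>2 * snd w)"

lemma nn_integral_hpoint:
  fixes g :: "'n::finite hpoint \<Rightarrow> ennreal"
  assumes "g \<in> borel_measurable borel"
  shows "(\<integral>\<^sup>+w. g w \<partial>lborel) = (\<integral>\<^sup>+x. \<integral>\<^sup>+t. g (x, t) \<partial>lborel \<partial>lborel)"
  using assms unfolding lborel_prod[symmetric]
  by (subst lborel.nn_integral_fst) (simp_all add: lborel_prod)

lemma continuous_on_hdil [continuous_intros]: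
  "continuous_on S g \<Longrightarrow> continuous_on S (\<lambda>x. hdil c (g x))"
  unfolding hdil_def by (intro continuous_intros)

lemma borel_measurable_hmul_hinv [measurable]: 
   "(\<lambda>\<zeta>. hmul (hinv \<zeta>) z) \<in> borel_measurable borel"
  by (intro borel_measurable_continuous_onI continuous_intros)

lemma borel_measurable_hdil [measurable]: "hdil c \<in> borel_measurable borel"
  by (intro borel_measurable_continuous_onI continuous_intros)

text \<open>For fixed \<open>x\<close> the substitution reflects \<open>t\<close> about a centre
  depending on \<open>x\<close> only, and it then reflects \<open>x\<close>; Fubini gives the
  invariance. The variable is the pole \<open>\<zeta>\<close>, as in the potential.\<close>

lemma nn_integral_hmul_hinv:
  fixes g :: "'n::finite hpoint \<Rightarrow> ennreal"
  assumes g [measurable]: "g \<in> borel_measurable borel"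
  shows "(\<integral>\<^sup>+\<zeta>. g (hmul (hinv \<zeta>) z) \<partial>lborel) = (\<integral>\<^sup>+w. g w \<partial>lborel)"
proof -
  have m [measurable]: "(\<lambda>x. \<integral>\<^sup>+t. g (x, t) \<partial>lborel) \<in> borel_measurable borel"
    using lborel.borel_measurable_nn_integral_fst[of g borel] g by (simp add: borel_prod)
  have gx [measurable]: "(\<lambda>t. g (x, t)) \<in> borel_measurable borel" for x
    using g by measurable
  have "(\<integral>\<^sup>+\<zeta>. g (hmul (hinv \<zeta>) z) \<partial>lborel) =
     (\<integral>\<^sup>+x. \<integral>\<^sup>+t. g (hmul (hinv (x, t)) z) \<partial>lborel \<partial>lborel)"
    by (rule nn_integral_hpoint) measurable
  also have "\<dots> = (\<integral>\<^sup>+x. \<integral>\<^sup>+t. g (fst z + (-1) *\<^sub>R x, (snd z + 2 * ((Jmat *v - x) \<bullet> fst z)) + (-1) *\<^sub>R t) \<partial>lborel \<partial>lborel)"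
    by (simp add: hmul_def hinv_def algebra_simps)
  also have "\<dots> = (\<integral>\<^sup>+x. \<integral>\<^sup>+t. g (fst z + (-1) *\<^sub>R x, t) \<partial>lborel \<partial>lborel)"
    using nn_integral_lborel_affine[OF gx, of "-1"] by simp
  also have "\<dots> = (\<integral>\<^sup>+x. \<integral>\<^sup>+t. g (x, t) \<partial>lborel \<partial>lborel)"
    using nn_integral_lborel_affine[OF m, of "-1" "fst z"] by simp
  also have "\<dots> = (\<integral>\<^sup>+w. g w \<partial>lborel)" by (rule nn_integral_hpoint[symmetric]) measurable
  finally show ?thesis .
qed

text \<open>The Jacobian is \<open>c^(2n)\<close> from \<open>x\<close> times \<open>c^2\<close>
  from \<open>t\<close>, that is, \<open>c^Q\<close>.\<close>

lemma nn_integral_hdil: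
  fixes g :: "'n::finite hpoint \<Rightarrow> ennreal"
  assumes g [measurable]: "g \<in> borel_measurable borel" and c: "0 < c"
  shows "ennreal (c ^ (2 * CARD('n) + 2)) * (\<integral>\<^sup>+w. g (hdil c w) \<partial>lborel) = (\<integral>\<^sup>+w. g w \<partial>lborel)"
proof -
  have m [measurable]: "(\<lambda>x. \<integral>\<^sup>+t. g (x, t) \<partial>lborel) \<in> borel_measurable borel"
    using lborel.borel_measurable_nn_integral_fst[of g borel] g by (simp add: borel_prod)
  have gx [measurable]: "(\<lambda>t. g (x, t)) \<in> borel_measurable borel" for x
    using g by measurable
  have e: "ennreal (c ^ (2 * CARD('n) + 2)) = ennreal (c ^ (2 * CARD('n))) * ennreal (c\<^sup>2)"
    unfolding power_add using c by (intro ennreal_mult) simp_all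
  have t: "ennreal (c\<^sup>2) * (\<integral>\<^sup>+t. g (x, c\<^sup>2 * t) \<partial>lborel) = (\<integral>\<^sup>+t. g (x, t) \<partial>lborel)" for x
    using nn_integral_lborel_affine[OF gx[of x], of "c\<^sup>2" 0] c by simp
  have m2 [measurable]: "(\<lambda>x. \<integral>\<^sup>+t. g (x, c\<^sup>2 * t) \<partial>lborel) \<in> borel_measurable borel"
    using lborel.borel_measurable_nn_integral_fst[of "\<lambda>w. g (fst w, c\<^sup>2 * snd w)" borel] g by (simp add: borel_prod)
  have m3 [measurable]: "(\<lambda>x. \<integral>\<^sup>+t. g (c *\<^sub>R x, c\<^sup>2 * t) \<partial>lborel) \<in> borel_measurable borel"
    using measurable_compose[OF _ m2, of "\<lambda>x. c *\<^sub>R x"] by simp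
  have "ennreal (c ^ (2 * CARD('n) + 2)) * (\<integral>\<^sup>+w. g (hdil c w) \<partial>lborel) =
      ennreal (c ^ (2 * CARD('n))) * (ennreal (c\<^sup>2) * (\<integral>\<^sup>+x. \<integral>\<^sup>+t. g (c *\<^sub>R x, c\<^sup>2 * t) \<partial>lborel \<partial>lborel))"
    using c by (subst nn_integral_hpoint, measurable) (simp only: hdil_def e mult.assoc fst_conv snd_conv)
  also have "\<dots> = ennreal (c ^ (2 * CARD('n))) * (\<integral>\<^sup>+x. \<integral>\<^sup>+t. g (c *\<^sub>R x, t) \<partial>lborel \<partial>lborel)"
    by (subst nn_integral_cmult[symmetric]) (simp_all add: t)
  also have "\<dots> = (\<integral>\<^sup>+x. \<integral>\<^sup>+t. g (x, t) \<partial>lborel \<partial>lborel)"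
    using nn_integral_lborel_affine[OF m, of c 0] c by (simp add: mult_2)
  also have "\<dots> = (\<integral>\<^sup>+w. g w \<partial>lborel)" by (rule nn_integral_hpoint[symmetric]) measurable
  finally show ?thesis .
qed

lemma emeasure_hmul_hinv:
  assumes [measurable]: "S \<in> sets borel"
  shows "emeasure lborel {\<zeta>. hmul (hinv \<zeta>) z \<in> S} = emeasure lborel S"
proof -
  have [measurable]: "{\<zeta>. hmul (hinv \<zeta>) z \<in> S} \<in> sets borel" by measurable
  have "emeasure lborel {\<zeta>. hmul (hinv \<zeta>) z \<in> S} = (\<integral>\<^sup>+\<zeta>. indicator S (hmul (hinv \<zeta>) z) \<partial>lborel)"
    using nn_integral_indicator[of "{\<zeta>. hmul (hinv \<zeta>) z \<in> S}" lborel] by (simp add: indicator_def)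
  also have "\<dots> = emeasure lborel S" by (subst nn_integral_hmul_hinv) simp_all
  finally show ?thesis .
qed

lemma emeasure_hdil:
  fixes S :: "'n::finite hpoint set"
  assumes [measurable]: "S \<in> sets borel" and c: "0 < c"
  shows "emeasure lborel S = ennreal (c ^ (2 * CARD('n) + 2)) * emeasure lborel {w. hdil c w \<in> S}"
proof -
  have [measurable]: "{w. hdil c w \<in> S} \<in> sets borel" by measurable
  have "emeasure lborel {w. hdil c w \<in> S} = (\<integral>\<^sup>+w. indicator S (hdil c w) \<partial>lborel)"
    using nn_integral_indicator[of "{w. hdil c w \<in> S}" lborel] by (simp add: indicator_def)
  then show ?thesis using nn_integral_hdil[of "indicator S" c] c by simp
qed

text \<open>The lower bound for the second derivatives of the kernel degenerates when the pole and
  the point lie on one vertical line; such poles form a null set.\<close>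

lemma emeasure_fst_eq: "emeasure lborel {w::'n::finite hpoint. fst w = a} = 0"
proof -
  have "{w::'n hpoint. fst w = a} = {a} \<times> UNIV" by auto
  then show ?thesis
    unfolding lborel_prod[symmetric] by (simp add: lborel.emeasure_pair_measure_Times)
qed

text \<open>\<open>B\<close> collects the large values of \<open>K\<close>: exchanging
  \<open>F - B\<close> for \<open>B - F\<close>, which is at least as large in measure, replaces
  values at most \<open>c\<close> by values at least \<open>c\<close>.\<close>

lemma bathtub:
  fixes K :: "'a \<Rightarrow> ennreal"
  assumes [measurable]: "K \<in> borel_measurable M" "F \<in> sets M" "B \<in> sets M"
    and le: "emeasure M F \<le> emeasure M B" and fin: "emeasure M B < \<infinity>"
    and ge: "\<And>x. x \<in> B \<Longrightarrow> c \<le> K x" and less: "\<And>x. x \<notin> B \<Longrightarrow> K x \<le> c"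
  shows "(\<integral>\<^sup>+x. K x * indicator F x \<partial>M) \<le> (\<integral>\<^sup>+x. K x * indicator B x \<partial>M)"
proof -
  let ?I = "\<lambda>S. \<integral>\<^sup>+x. K x * indicator S x \<partial>M"
  have split: "?I S = ?I (S \<inter> T) + ?I (S - T)" if [measurable]: "S \<in> sets M" "T \<in> sets M" for S T
    by (subst nn_integral_add[symmetric]) (auto intro!: nn_integral_cong simp: indicator_def)
  have "?I (F - B) \<le> (\<integral>\<^sup>+x. c * indicator (F - B) x \<partial>M)"
    by (intro nn_integral_mono) (auto simp: indicator_def less)
  also have "\<dots> = c * emeasure M (F - B)" by (simp add: nn_integral_cmult_indicator)
  also have "\<dots> \<le> c * emeasure M (B - F)"
  proof (intro mult_left_mono)
    have "emeasure M (F \<inter> B) + emeasure M (F - B) = emeasure M F"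
      by (subst plus_emeasure) (auto intro!: arg_cong[where f = "emeasure M"])
    also have "\<dots> \<le> emeasure M B" by (rule le)
    also have "\<dots> = emeasure M (F \<inter> B) + emeasure M (B - F)"
      by (subst plus_emeasure) (auto intro!: arg_cong[where f = "emeasure M"])
    \<comment> \<open>The common part \<open>F \<inter> B\<close> can be cancelled because its
      measure is finite.\<close>
    finally show "emeasure M (F - B) \<le> emeasure M (B - F)"
      using fin emeasure_mono[of "F \<inter> B" B M] by (simp add: ennreal_add_left_cancel_le) (auto simp: top_unique)
  qed simp
  also have "\<dots> = (\<integral>\<^sup>+x. c * indicator (B - F) x \<partial>M)" by (simp add: nn_integral_cmult_indicator)
  also have "\<dots> \<le> ?I (B - F)" by (intro nn_integral_mono) (auto simp: indicator_def ge)
  finally have "?I (F - B) \<le> ?I (B - F)" .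
  then show ?thesis using split[of F B] split[of B F] by (simp add: Int_commute add_left_mono)
qed

section \<open>The kernel\<close>

definition hform :: "real^('n::finite + 'n)^('n + 'n) \<Rightarrow> 'n hpoint \<Rightarrow> real" where
  "hform P w = (fst w \<bullet> (P *v fst w))\<^sup>2 + (snd w)\<^sup>2"

text \<open>This is \<open>Q - 1\<close>; the type argument carries the dimension.\<close>

definition hexp :: "'n::finite itself \<Rightarrow> nat" where
  "hexp _ = 2 * CARD('n) + 1"

text \<open>The homogeneous dimension is \<open>Q = 2n + 2\<close>; the kernel is \<open>\<rho>\<^sub>P\<close> to the power \<open>1 - Q\<close>, whose value at the
  pole is \<open>\<infinity>\<close>. The exponent lies strictly between \<open>2 - Q\<close>, where the kernel would be the fundamental
  solution, and the threshold \<open>- Q\<close> of local integrability.\<close>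

definition hker :: "real^('n::finite + 'n)^('n + 'n) \<Rightarrow> 'n hpoint \<Rightarrow> ennreal" where
  "hker P w = inverse (ennreal (hform P w powr (real (hexp TYPE('n)) / 4)))"

definition fball :: "real^('n::finite + 'n)^('n + 'n) \<Rightarrow> real \<Rightarrow> 'n hpoint set" where
  "fball P s = {w. hform P w \<le> s ^ 4}"

definition fmass :: "real^('n::finite + 'n)^('n + 'n) \<Rightarrow> real \<Rightarrow> ennreal" where
  "fmass P s = (\<integral>\<^sup>+w. hker P w * indicator (fball P s) w \<partial>lborel)"

lemma ennreal_mult_assoc:
  "0 \<le> a \<Longrightarrow> 0 \<le> b \<Longrightarrow> ennreal a * (ennreal b * x) = ennreal (a * b) * x"
  by (simp add: ennreal_mult mult.assoc)

lemma hform_nonneg: "0 \<le> hform P w"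
  by (simp add: hform_def)

lemma continuous_on_hform [continuous_intros]:
  assumes "continuous_on S g" shows "continuous_on S (\<lambda>x. hform P (g x))"
  unfolding hform_def
  by (intro continuous_intros assms)

lemma borel_measurable_hform [measurable]: "hform P \<in> borel_measurable borel"
  by (intro borel_measurable_continuous_onI continuous_intros)

lemma borel_measurable_hker [measurable]: "hker P \<in> borel_measurable borel"
  unfolding hker_def by measurable

lemma fball_borel [measurable]: "fball P s \<in> sets borel"
  unfolding fball_def by measurable

lemma hform_hdil: "hform P (hdil c w) = c ^ 4 * hform P w"
proof -
  have "fst (hdil c w) \<bullet> (P *v fst (hdil c w)) = c\<^sup>2 * (fst w \<bullet> (P *v fst w))"
    by (simp add: hdil_def matrix_vector_mult_scaleR power2_eq_square)
  moreover have "(c\<^sup>2)\<^sup>2 = c ^ 4" by simp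
  ultimately show ?thesis
    by (simp add: hform_def hdil_def power_mult_distrib distrib_left)
qed

lemma powr_pow4: 
  assumes "0 < (c::real)" shows "(c ^ 4) powr (real k / 4) = c ^ k"
proof -
  have "(c ^ 4) powr (real k / 4) = (c powr 4) powr (real k / 4)"
    using powr_realpow[OF assms, of 4] by simp
  also have "\<dots> = c powr real k" by (simp add: powr_powr)
  finally show ?thesis using assms by (simp add: powr_realpow)
qed

lemma hker_hdil:
  fixes P :: "real^('n::finite + 'n)^('n + 'n)"
  assumes c: "0 < c"
  shows "hker P (hdil c w) = ennreal (1 / c ^ hexp TYPE('n)) * hker P w"
proof -
  have "hform P (hdil c w) powr (real (hexp TYPE('n)) / 4) =
     c ^ hexp TYPE('n) * hform P w powr (real (hexp TYPE('n)) / 4)"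
    unfolding hform_hdil powr_mult powr_pow4[OF c] ..
  then have "ennreal (hform P (hdil c w) powr (real (hexp TYPE('n)) / 4)) =
     ennreal (c ^ hexp TYPE('n)) * ennreal (hform P w powr (real (hexp TYPE('n)) / 4))"
    using c by (simp only:) (rule ennreal_mult, simp_all)
  then have "hker P (hdil c w) = inverse (ennreal (c ^ hexp TYPE('n))) * hker P w"
    unfolding hker_def by (simp only:) (rule ennreal_inverse_mult, simp_all)
  also have "inverse (ennreal (c ^ hexp TYPE('n))) = ennreal (1 / c ^ hexp TYPE('n))"
    using c by (subst inverse_ennreal) (simp_all only: inverse_eq_divide zero_less_power)
  finally show ?thesis .
qed

lemma fball_hdil: "0 < c \<Longrightarrow> hdil c w \<in> fball P (c * s) \<longleftrightarrow> w \<in> fball P s"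
  unfolding fball_def mem_Collect_eq hform_hdil power_mult_distrib
  by (rule mult_le_cancel_left_pos) simp

text \<open>Volume scales by \<open>c^Q\<close> and the kernel by \<open>c^(1-Q)\<close>, which
  leaves one power of \<open>c\<close>.\<close>

lemma fmass_scale:
  fixes P :: "real^('n::finite + 'n)^('n + 'n)"
  assumes c: "0 < c"
  shows "fmass P (c * s) = ennreal c * fmass P s"
proof -
  let ?K = "hexp TYPE('n)"
  have "fmass P (c * s) = ennreal (c ^ (?K + 1)) * 
     (\<integral>\<^sup>+w. hker P (hdil c w) * indicator (fball P (c * s)) (hdil c w) \<partial>lborel)"
    unfolding fmass_def by (subst nn_integral_hdil[OF _ c, symmetric]) (simp_all add: hexp_def)
  also have "\<dots> = ennreal (c ^ (?K + 1)) * (\<integral>\<^sup>+w. ennreal (1 / c ^ ?K) * (hker P w * indicator (fball P s) w) \<partial>lborel)"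
    using c by (simp add: hker_hdil indicator_def fball_hdil mult.assoc)
  also have "\<dots> = ennreal (c ^ (?K + 1)) * (ennreal (1 / c ^ ?K) * fmass P s)"
    unfolding fmass_def by (subst nn_integral_cmult) simp_all
  also have "\<dots> = ennreal c * fmass P s"
    using c by (simp add: ennreal_mult_assoc)
  finally show ?thesis .
qed

lemma hker_le:
  fixes P :: "real^('n::finite + 'n)^('n + 'n)"
  assumes s: "0 < s" and w: "s ^ 4 \<le> hform P w"
  shows "hker P w \<le> ennreal (1 / s ^ hexp TYPE('n))"
proof -
  have "s ^ hexp TYPE('n) \<le> hform P w powr (real (hexp TYPE('n)) / 4)"
    using powr_mono2[OF _ _ w, of "real (hexp TYPE('n)) / 4"] s powr_pow4[OF s, of "hexp TYPE('n)"]
    by simp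
  moreover have "0 < s ^ hexp TYPE('n)" using s by simp
  ultimately show ?thesis
    unfolding hker_def by (subst inverse_ennreal) (auto intro!: ennreal_leI simp: inverse_eq_divide frac_le)
qed

lemma hker_ge:
  fixes P :: "real^('n::finite + 'n)^('n + 'n)"
  assumes s: "0 < s" and w: "hform P w \<le> s ^ 4"
  shows "ennreal (1 / s ^ hexp TYPE('n)) \<le> hker P w"
proof -
  have le: "hform P w powr (real (hexp TYPE('n)) / 4) \<le> s ^ hexp TYPE('n)"
    using powr_mono2[OF _ hform_nonneg w, of "real (hexp TYPE('n)) / 4"] powr_pow4[OF s, of "hexp TYPE('n)"]
    by simp
  show ?thesis
  proof (cases "hform P w powr (real (hexp TYPE('n)) / 4) = 0")
    case True
    then show ?thesis unfolding hker_def by (simp only: ennreal_0) simp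
  next
    case False
    then have pos: "0 < hform P w powr (real (hexp TYPE('n)) / 4)" by (simp only: less_le) simp
    then have "1 / s ^ hexp TYPE('n) \<le> inverse (hform P w powr (real (hexp TYPE('n)) / 4))"
      unfolding inverse_eq_divide using le by (intro frac_le) simp_all
    then show ?thesis unfolding hker_def inverse_ennreal[OF pos] by (rule ennreal_leI)
  qed
qed

lemma norm_pow4: "norm x ^ 4 = (x \<bullet> x)\<^sup>2"
  using power_mult[of "norm x" 2 2] by (simp add: dot_square_norm)

lemma real_sqrt_pow4: "0 \<le> x \<Longrightarrow> sqrt x ^ 4 = x\<^sup>2"
  using power_mult[of "sqrt x" 2 2] by simp

section \<open>Balls of \<open>hform P\<close> for an elliptic matrix, and their mass\<close>

locale hform_bounds =
  fixes P :: "real^('n::finite + 'n)^('n + 'n)" and lam Lam :: real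
  assumes lam_pos: "0 < lam" and lam_le: "lam \<le> 1" and Lam_ge: "1 \<le> Lam"
    and form_ge: "lam * (x \<bullet> x) \<le> x \<bullet> (P *v x)"
    and form_le: "x \<bullet> (P *v x) \<le> Lam * (x \<bullet> x)"
begin

lemma form_nonneg: "0 \<le> x \<bullet> (P *v x)"
proof -
  have "0 \<le> lam * (x \<bullet> x)" using lam_pos by simp
  with form_ge[of x] show ?thesis by linarith
qed

lemma hform_ge: "lam\<^sup>2 * hgauge w ^ 4 \<le> hform P w"
proof -
  have "(lam * (fst w \<bullet> fst w))\<^sup>2 \<le> (fst w \<bullet> (P *v fst w))\<^sup>2"
    using form_ge[of "fst w"] lam_pos by (intro power_mono) simp_all
  \<comment> \<open>The vertical term has coefficient 1 in \<open>hform\<close>, so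
    \<open>lam \<le> 1\<close> is what makes the common factor \<open>lam^2\<close>
    possible.\<close>
  moreover have "lam\<^sup>2 * (snd w)\<^sup>2 \<le> 1 * (snd w)\<^sup>2"
    using lam_pos lam_le by (intro mult_right_mono) (simp_all add: power_le_one)
  ultimately show ?thesis
    unfolding hform_def hgauge_pow4 norm_pow4 distrib_left power_mult_distrib by linarith
qed

lemma hform_le: "hform P w \<le> Lam\<^sup>2 * hgauge w ^ 4"
proof -
  have "(fst w \<bullet> (P *v fst w))\<^sup>2 \<le> (Lam * (fst w \<bullet> fst w))\<^sup>2"
    using form_le[of "fst w"] form_nonneg[of "fst w"] by (intro power_mono) simp_all
  moreover have "1 * (snd w)\<^sup>2 \<le> Lam\<^sup>2 * (snd w)\<^sup>2"
    using Lam_ge by (intro mult_right_mono) (simp_all add: one_le_power)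
  ultimately show ?thesis
    unfolding hform_def hgauge_pow4 norm_pow4 distrib_left power_mult_distrib by linarith
qed

lemma hform_pos: "w \<noteq> 0 \<Longrightarrow> 0 < hform P w"
proof -
  assume "w \<noteq> 0"
  then have "0 < hgauge w" using hgauge_eq_0_iff[of w] hgauge_nonneg[of w] by linarith
  then have "0 < lam\<^sup>2 * hgauge w ^ 4" using lam_pos by simp
  with hform_ge[of w] show ?thesis by linarith
qed

lemma fball_gauge: 
  assumes w: "w \<in> fball P s" and s: "0 < s"
  shows "sqrt lam * hgauge w \<le> s"
proof -
  have "(sqrt lam * hgauge w) ^ 4 = lam\<^sup>2 * hgauge w ^ 4"
    using lam_pos by (simp add: power_mult_distrib real_sqrt_pow4)
  also have "\<dots> \<le> s ^ 4" using hform_ge[of w] w by (simp add: fball_def)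
  finally show ?thesis
    by (rule power_mono_iff[THEN iffD1, rotated -1]) (use s lam_pos in \<open>simp_all add: hgauge_nonneg\<close>)
qed

lemma gauge_fball:
  assumes w: "sqrt Lam * hgauge w \<le> s"
  shows "w \<in> fball P s"
proof -
  have "Lam\<^sup>2 * hgauge w ^ 4 = (sqrt Lam * hgauge w) ^ 4"
    using Lam_ge by (simp add: power_mult_distrib real_sqrt_pow4)
  also have "\<dots> \<le> s ^ 4" using Lam_ge by (intro power_mono w) (simp add: hgauge_nonneg)
  finally show ?thesis using hform_le[of w] by (simp add: fball_def)
qed

lemma emeasure_fball_finite: "0 < s \<Longrightarrow> emeasure lborel (fball P s) < \<infinity>"
proof -
  assume s: "0 < s"
  have "fball P s \<subseteq> {w. hgauge w \<le> s / sqrt lam}"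
    using fball_gauge[OF _ s] lam_pos by (auto simp: field_simps)
  then have "bounded (fball P s)"
    by (rule bounded_subset[OF compact_imp_bounded[OF compact_hgauge_le]])
  then show ?thesis by (rule emeasure_bounded_finite)
qed

text \<open>Dilation by 1/2 shows that the ball of half the radius carries at most half of the mass,
  and outside it the kernel is bounded. For the truncated kernel this reads
  \<open>J c \<le> J c / 2 + const\<close>, which gives a bound uniform in the truncation
  level.\<close>

lemma fmass_finite:
  assumes s: "0 < s" shows "fmass P s < \<infinity>"
proof -
  let ?K = "hexp TYPE('n)" and ?v = "emeasure lborel (fball P 1)"
  \<comment> \<open>Truncation makes the integral finite, so that half of it may be subtracted
    below.\<close>
  define J where "J c = (\<integral>\<^sup>+w. min (hker P w) (of_nat c) * indicator (fball P 1) w \<partial>lborel)" for c :: nat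
  have v: "?v < \<infinity>" by (rule emeasure_fball_finite) simp
  have J_le: "J c \<le> ennreal (2 * 2 ^ ?K) * ?v" for c
  proof -
    have Jfin: "J c < \<infinity>"
    proof -
      have "J c \<le> (\<integral>\<^sup>+w. of_nat c * indicator (fball P 1) w \<partial>lborel)"
        unfolding J_def by (intro nn_integral_mono mult_right_mono) simp_all
      also have "\<dots> = of_nat c * ?v" by (subst nn_integral_cmult_indicator) simp_all
      also have "\<dots> < \<infinity>" using v by (simp add: ennreal_mult_less_top of_nat_less_top)
      finally show ?thesis .
    qed
    have half: "(\<integral>\<^sup>+w. min (hker P w) (of_nat c) * indicator (fball P (1/2)) w \<partial>lborel) \<le> ennreal (1/2) * J c"
    proof -
      have "(\<integral>\<^sup>+w. min (hker P w) (of_nat c) * indicator (fball P (1/2)) w \<partial>lborel) =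
         ennreal ((1/2) ^ (?K + 1)) * (\<integral>\<^sup>+w. min (hker P (hdil (1/2) w)) (of_nat c) * indicator (fball P (1/2)) (hdil (1/2) w) \<partial>lborel)"
        by (subst nn_integral_hdil[symmetric, of _ "1/2"]) (simp_all add: hexp_def)
      also have "\<dots> \<le> ennreal ((1/2) ^ (?K + 1)) * (\<integral>\<^sup>+w. ennreal (2 ^ ?K) * (min (hker P w) (of_nat c) * indicator (fball P 1) w) \<partial>lborel)"
      proof (intro mult_left_mono nn_integral_mono)
        fix w
        \<comment> \<open>Since \<open>2 ^ ?K \<ge> 1\<close>, truncating after scaling gives at
          most the scaled truncation.\<close>
        have "min (ennreal (2 ^ ?K) * hker P w) (of_nat c) \<le> ennreal (2 ^ ?K) * min (hker P w) (of_nat c)"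
        proof (cases "hker P w \<le> of_nat c")
          case False
          have "1 * of_nat c \<le> ennreal (2 ^ ?K) * of_nat c"
            by (intro mult_right_mono) (simp_all add: one_le_power)
          moreover have "min (hker P w) (of_nat c) = of_nat c" using False by (simp add: min_def)
          ultimately show ?thesis by (simp add: min.coboundedI2)
        next
          case True
          then have "min (hker P w) (of_nat c) = hker P w" by (simp add: min_def)
          then show ?thesis by simp
        qed
        then show "min (hker P (hdil (1/2) w)) (of_nat c) * indicator (fball P (1/2)) (hdil (1/2) w)
           \<le> ennreal (2 ^ ?K) * (min (hker P w) (of_nat c) * indicator (fball P 1) w)"
          using fball_hdil[of "1/2" w P 1] by (simp add: hker_hdil indicator_def power_one_over)
      qed simp
      also have "\<dots> = ennreal ((1/2) ^ (?K + 1)) * (ennreal (2 ^ ?K) * J c)"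
        unfolding J_def by (subst nn_integral_cmult) simp_all
      \<comment> \<open>The Jacobian \<open>2^(-Q)\<close> meets the kernel factor
        \<open>2^(Q-1)\<close>.\<close>
      also have "\<dots> = ennreal (1/2) * J c"
        by (simp add: ennreal_mult_assoc power_one_over)
      finally show ?thesis .
    qed
    have "J c \<le> (\<integral>\<^sup>+w. min (hker P w) (of_nat c) * indicator (fball P (1/2)) w + ennreal (2 ^ ?K) * indicator (fball P 1) w \<partial>lborel)"
      unfolding J_def
    proof (intro nn_integral_mono)
      fix w
      show "min (hker P w) (of_nat c) * indicator (fball P 1) w
        \<le> min (hker P w) (of_nat c) * indicator (fball P (1/2)) w + ennreal (2 ^ ?K) * indicator (fball P 1) w"
      proof (cases "w \<in> fball P (1/2)")
        case False
        then have "hker P w \<le> ennreal (2 ^ ?K)"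
          using hker_le[of "1/2" P w] by (simp add: fball_def power_one_over)
        then have "min (hker P w) (of_nat c) \<le> ennreal (2 ^ ?K)" by (simp add: min.coboundedI1)
        then show ?thesis by (simp add: indicator_def)
      qed (simp add: indicator_def)
    qed
    also have "\<dots> = (\<integral>\<^sup>+w. min (hker P w) (of_nat c) * indicator (fball P (1/2)) w \<partial>lborel) + ennreal (2 ^ ?K) * ?v"
      by (subst nn_integral_add) (simp_all add: nn_integral_cmult_indicator)
    also have "\<dots> \<le> ennreal (1/2) * J c + ennreal (2 ^ ?K) * ?v" by (intro add_right_mono half)
    finally have "J c \<le> ennreal (1/2) * J c + ennreal (2 ^ ?K) * ?v" .
    moreover obtain j where j: "J c = ennreal j" "0 \<le> j" using Jfin by (cases "J c") auto
    moreover obtain v' where v': "?v = ennreal v'" "0 \<le> v'" using v by (cases ?v) auto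
    moreover have "ennreal (1/2 * j + 2 ^ ?K * v') = ennreal (1/2) * ennreal j + ennreal (2 ^ ?K) * ennreal v'"
    proof -
      have "ennreal (1/2 * j) = ennreal (1/2) * ennreal j" "ennreal (2 ^ ?K * v') = ennreal (2 ^ ?K) * ennreal v'"
        using j(2) v'(2) by (intro ennreal_mult; simp)+
      moreover have "ennreal (1/2 * j + 2 ^ ?K * v') = ennreal (1/2 * j) + ennreal (2 ^ ?K * v')"
        using j(2) v'(2) by (intro ennreal_plus) simp_all
      ultimately show ?thesis by (simp only:)
    qed
    ultimately have "ennreal j \<le> ennreal (1/2 * j + 2 ^ ?K * v')" by (simp only:)
    then have "j \<le> 1/2 * j + 2 ^ ?K * v'" using j v' by (subst (asm) ennreal_le_iff) auto
    then have "j \<le> 2 * 2 ^ ?K * v'" by simp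
    then show ?thesis unfolding j v' using v' by (subst ennreal_mult[symmetric]) (auto intro!: ennreal_leI)
  qed
  \<comment> \<open>Monotone convergence removes the truncation.\<close>
  have "fmass P 1 = (\<integral>\<^sup>+w. (SUP c. min (hker P w) (of_nat c) * indicator (fball P 1) w) \<partial>lborel)"
    unfolding fmass_def
  proof (intro nn_integral_cong)
    fix w
    have "(SUP c. min (hker P w) (of_nat c)) = hker P w"
      by (simp add: inf_min[symmetric] inf_SUP[symmetric] ennreal_SUP_of_nat_eq_top)
    then show "hker P w * indicator (fball P 1) w = (SUP c. min (hker P w) (of_nat c) * indicator (fball P 1) w)"
      by (simp add: indicator_def)
  qed
  also have "\<dots> = (SUP c. J c)"
    unfolding J_def
  proof (intro nn_integral_monotone_convergence_SUP)
    show "incseq (\<lambda>c w. min (hker P w) (of_nat c) * indicator (fball P 1) w)"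
      by (intro monoI le_funI mult_right_mono min.mono order_refl of_nat_mono) simp_all
  qed measurable
  also have "\<dots> \<le> ennreal (2 * 2 ^ ?K) * ?v" by (intro SUP_least J_le)
  also have "\<dots> < \<infinity>" using v by (simp add: ennreal_mult_less_top)
  finally have "fmass P 1 < \<infinity>" .
  then show ?thesis using fmass_scale[OF s, of P 1] by (simp add: ennreal_mult_less_top)
qed

lemma fmass_ge:
  assumes s: "0 < s"
  shows "ennreal (1 / s ^ hexp TYPE('n)) * emeasure lborel (fball P s) \<le> fmass P s"
proof -
  have "ennreal (1 / s ^ hexp TYPE('n)) * emeasure lborel (fball P s) =
     (\<integral>\<^sup>+w. ennreal (1 / s ^ hexp TYPE('n)) * indicator (fball P s) w \<partial>lborel)"
    by (simp add: nn_integral_cmult_indicator)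
  also have "\<dots> \<le> fmass P s"
    unfolding fmass_def
    by (intro nn_integral_mono) (simp add: indicator_def fball_def hker_ge[OF s])
  finally show ?thesis .
qed

text \<open>The ball contains a Euclidean ball, and the kernel is bounded below on it. Positivity
  permits the later division by the mass.\<close>

lemma fmass_pos: 
  assumes s: "0 < s" shows "0 < fmass P s"
proof -
  have "open {w::'n hpoint. sqrt Lam * hgauge w < s}"
    by (intro open_Collect_less continuous_intros)
  moreover have "0 \<in> {w::'n hpoint. sqrt Lam * hgauge w < s}" using s hgauge_eq_0_iff[of "0::'n hpoint"] by simp
  ultimately obtain e where e: "0 < e" "ball 0 e \<subseteq> {w::'n hpoint. sqrt Lam * hgauge w < s}"
    using open_contains_ball by blast
  then have "ball 0 e \<subseteq> fball P s" using gauge_fball by fastforce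
  then have "emeasure lborel (ball (0::'n hpoint) e) \<le> emeasure lborel (fball P s)"
    by (intro emeasure_mono) simp_all
  moreover have "0 < emeasure lborel (ball (0::'n hpoint) e)"
    using e(1) emeasure_lborel_ball_finite[of "0::'n hpoint" e] by (simp add: emeasure_ball unit_ball_vol_pos)
  ultimately have "0 < emeasure lborel (fball P s)" by simp
  then have "0 < ennreal (1 / s ^ hexp TYPE('n)) * emeasure lborel (fball P s)"
    using s by (simp add: ennreal_zero_less_mult_iff)
  then show ?thesis using fmass_ge[OF s] by simp
qed

end


section \<open>Potentials of sets of poles\<close>

definition fpot :: "real^('n::finite + 'n)^('n + 'n) \<Rightarrow> 'n hpoint set \<Rightarrow> 'n hpoint \<Rightarrow> ennreal" where
  "fpot P H z = (\<integral>\<^sup>+\<zeta>. hker P (hmul (hinv \<zeta>) z) * indicator H \<zeta> \<partial>lborel)"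

text \<open>\<open>hform P\<close> is invariant under inversion, so this is the closed ball of
  radius \<open>s\<close> around \<open>z\<close>; the order of the factors is that of the kernel in
  \<open>fpot\<close>.\<close>

definition fnbhd :: "real^('n::finite + 'n)^('n + 'n) \<Rightarrow> real \<Rightarrow> 'n hpoint \<Rightarrow> 'n hpoint set" where
  "fnbhd P s z = {\<zeta>. hmul (hinv \<zeta>) z \<in> fball P s}"

lemma fnbhd_borel [measurable]: "fnbhd P s z \<in> sets borel"
  unfolding fnbhd_def by measurable

lemma emeasure_fnbhd: "emeasure lborel (fnbhd P s z) = emeasure lborel (fball P s)"
  unfolding fnbhd_def by (rule emeasure_hmul_hinv) measurable

lemma fpot_fnbhd: "fpot P (fnbhd P s z) z = fmass P s"
proof -
  have "fpot P (fnbhd P s z) z =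
    (\<integral>\<^sup>+\<zeta>. (\<lambda>w. hker P w * indicator (fball P s) w) (hmul (hinv \<zeta>) z) \<partial>lborel)"
    unfolding fpot_def fnbhd_def by (simp add: indicator_def)
  also have "\<dots> = fmass P s"
    unfolding fmass_def by (rule nn_integral_hmul_hinv) measurable
  finally show ?thesis .
qed

lemma fpot_Un_le:
  assumes [measurable]: "S \<in> sets borel" "T \<in> sets borel"
  shows "fpot P (S \<union> T) z \<le> fpot P S z + fpot P T z"
  unfolding fpot_def
  by (subst nn_integral_add[symmetric]) (auto intro!: nn_integral_mono simp: indicator_def)

lemma fpot_mono: "S \<subseteq> T \<Longrightarrow> fpot P S z \<le> fpot P T z"
  unfolding fpot_def by (intro nn_integral_mono mult_left_mono) (auto simp: indicator_def)

lemma fpot_le_off_pole: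
  fixes P :: "real^('n::finite + 'n)^('n + 'n)"
  assumes [measurable]: "H \<in> sets borel" and s: "0 < s"
    and far: "\<And>\<zeta>. \<zeta> \<in> H \<Longrightarrow> s ^ 4 \<le> hform P (hmul (hinv \<zeta>) z)"
  shows "fpot P H z \<le> ennreal (1 / s ^ hexp TYPE('n)) * emeasure lborel H"
proof -
  have "fpot P H z \<le> (\<integral>\<^sup>+\<zeta>. ennreal (1 / s ^ hexp TYPE('n)) * indicator H \<zeta> \<partial>lborel)"
    unfolding fpot_def
  proof (intro nn_integral_mono)
    fix \<zeta> show "hker P (hmul (hinv \<zeta>) z) * indicator H \<zeta> \<le> ennreal (1 / s ^ hexp TYPE('n)) * indicator H \<zeta>"
      using hker_le[OF s far] by (cases "\<zeta> \<in> H") simp_all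
  qed
  also have "\<dots> = ennreal (1 / s ^ hexp TYPE('n)) * emeasure lborel H"
    by (simp add: nn_integral_cmult_indicator)
  finally show ?thesis .
qed

lemma hexp_ge: "3 \<le> hexp TYPE('n::finite)"
  using zero_less_card_finite[where 'a = 'n] unfolding hexp_def by simp

context hform_bounds
begin

text \<open>The ball of radius \<open>s\<close> around \<open>z\<close> is a superlevel set of the
  kernel as a function of the pole, and \<open>H\<close> has no larger measure; so the bathtub
  principle applies at every \<open>z\<close>.\<close>

lemma fpot_le_fmass:
  assumes [measurable]: "H \<in> sets borel" and s: "0 < s" and H: "H \<subseteq> fnbhd P s z1"
  shows "fpot P H z \<le> fmass P s"
proof -
  have "fpot P H z \<le> fpot P (fnbhd P s z) z"
    unfolding fpot_def
  proof (rule bathtub[where c = "ennreal (1 / s ^ hexp TYPE('n))"])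
    have "emeasure lborel H \<le> emeasure lborel (fnbhd P s z1)" by (rule emeasure_mono[OF H]) simp
    then show "emeasure lborel H \<le> emeasure lborel (fnbhd P s z)" by (simp add: emeasure_fnbhd)
    show "emeasure lborel (fnbhd P s z) < \<infinity>" using emeasure_fball_finite[OF s] by (simp add: emeasure_fnbhd)
    fix \<zeta>
    show "\<zeta> \<in> fnbhd P s z \<Longrightarrow> ennreal (1 / s ^ hexp TYPE('n)) \<le> hker P (hmul (hinv \<zeta>) z)"
      by (intro hker_ge[OF s]) (simp add: fnbhd_def fball_def)
    show "\<zeta> \<notin> fnbhd P s z \<Longrightarrow> hker P (hmul (hinv \<zeta>) z) \<le> ennreal (1 / s ^ hexp TYPE('n))"
      by (intro hker_le[OF s]) (simp add: fnbhd_def fball_def)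
  qed simp_all
  then show ?thesis by (simp only: fpot_fnbhd)
qed

text \<open>At gauge distance \<open>2 * s\<close> the kernel is at most \<open>(2s)^(1-Q)\<close>,
  hence at most half of \<open>s^(1-Q)\<close>, its lower bound on the ball that defines
  \<open>fmass P s\<close>.\<close>

lemma fpot_le_half_fmass:
  assumes [measurable]: "H \<in> sets borel" and s: "0 < s" and H: "H \<subseteq> fnbhd P s z1"
    and far: "\<And>\<zeta>. \<zeta> \<in> H \<Longrightarrow> (2 * s) ^ 4 \<le> hform P (hmul (hinv \<zeta>) z)"
  shows "2 * fpot P H z \<le> fmass P s"
proof -
  let ?K = "hexp TYPE('n)"
  have "emeasure lborel H \<le> emeasure lborel (fnbhd P s z1)" by (rule emeasure_mono[OF H]) simp
  then have Hle: "emeasure lborel H \<le> emeasure lborel (fball P s)" by (simp add: emeasure_fnbhd)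
  have "2 * 1 / (2 * s) ^ ?K \<le> 1 / s ^ ?K"
  proof -
    have "(2::real) ^ 1 \<le> 2 ^ ?K" using hexp_ge[where 'n = 'n] by (intro power_increasing) simp_all
    then show ?thesis using s unfolding power_mult_distrib by (simp add: divide_simps)
  qed
  then have "2 * (1 / (2 * s) ^ ?K) \<le> 1 / s ^ ?K" by simp
  note c = ennreal_leI[OF this]
  have "2 * fpot P H z \<le> ennreal 2 * (ennreal (1 / (2 * s) ^ ?K) * emeasure lborel H)"
    using fpot_le_off_pole[of H "2 * s" P z, OF _ _ far] s by (simp add: mult_left_mono)
  also have "\<dots> = ennreal (2 * (1 / (2 * s) ^ ?K)) * emeasure lborel H"
    using s by (intro ennreal_mult_assoc) simp_all
  also have "\<dots> \<le> ennreal (1 / s ^ ?K) * emeasure lborel (fball P s)"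
    by (intro mult_mono c Hle) simp_all
  also have "\<dots> \<le> fmass P s" by (rule fmass_ge[OF s])
  finally show ?thesis .
qed

text \<open>The part of the ball missed by \<open>H\<close> contributes at most a quarter of the
  mass: an eighth from the ball of radius \<open>s/8\<close>, by scaling, and an eighth from the
  rest, where the kernel is bounded and the measure is small.\<close>

lemma fmass_le_fpot:
  assumes [measurable]: "H \<in> sets borel" and s: "0 < s"
    and small: "emeasure lborel (fnbhd P s z1 - H) \<le> ennreal ((1/8) ^ hexp TYPE('n) / 8) * emeasure lborel (fball P s)"
  shows "fmass P s \<le> fpot P H z1 + ennreal (1/4) * fmass P s"
proof -
  let ?K = "hexp TYPE('n)" and ?E = "fnbhd P s z1 - H" and ?N = "fnbhd P (1/8 * s) z1"
  have s8: "0 < 1/8 * s" using s by simp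
  have "fpot P (?E - ?N) z1 \<le> ennreal (1 / (1/8 * s) ^ ?K) * emeasure lborel (?E - ?N)"
    by (intro fpot_le_off_pole s8) (simp_all add: fnbhd_def fball_def)
  also have "\<dots> \<le> ennreal (1 / (1/8 * s) ^ ?K) * (ennreal ((1/8) ^ ?K / 8) * emeasure lborel (fball P s))"
    by (intro mult_left_mono order.trans[OF _ small] emeasure_mono) auto
  also have "\<dots> = ennreal (1 / (1/8 * s) ^ ?K * ((1/8) ^ ?K / 8)) * emeasure lborel (fball P s)"
    using s by (intro ennreal_mult_assoc) simp_all
  \<comment> \<open>The factor \<open>(1/8) ^ ?K\<close> in \<open>small\<close> compensates the
    size of the kernel at radius \<open>s/8\<close>; the other factor 1/8 is the share of the mass
    that is allowed.\<close>
  also have "1 / (1/8 * s) ^ ?K * ((1/8) ^ ?K / 8) = 1/8 * (1 / s ^ ?K)"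
    using s unfolding power_mult_distrib by simp
  also have "ennreal (1/8 * (1 / s ^ ?K)) * emeasure lborel (fball P s) =
     ennreal (1/8) * (ennreal (1 / s ^ ?K) * emeasure lborel (fball P s))"
    using s by (intro ennreal_mult_assoc[symmetric]) simp_all
  also have "\<dots> \<le> ennreal (1/8) * fmass P s" by (intro mult_left_mono fmass_ge s) simp
  finally have 1: "fpot P (?E - ?N) z1 \<le> ennreal (1/8) * fmass P s" .
  have 2: "fpot P ?N z1 = ennreal (1/8) * fmass P s"
    unfolding fpot_fnbhd by (rule fmass_scale) simp
  have "fmass P s = fpot P (fnbhd P s z1) z1" by (rule fpot_fnbhd[symmetric])
  also have "\<dots> \<le> fpot P (H \<union> (?N \<union> (?E - ?N))) z1" by (rule fpot_mono) auto
  also have "\<dots> \<le> fpot P H z1 + fpot P (?N \<union> (?E - ?N)) z1" by (rule fpot_Un_le) measurable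
  also have "\<dots> \<le> fpot P H z1 + (fpot P ?N z1 + fpot P (?E - ?N) z1)"
    by (intro add_left_mono fpot_Un_le) measurable
  also have "\<dots> \<le> fpot P H z1 + (ennreal (1/8) * fmass P s + ennreal (1/8) * fmass P s)"
    unfolding 2 by (intro add_left_mono 1)
  also have "ennreal (1/8) * fmass P s + ennreal (1/8) * fmass P s = ennreal (1/4) * fmass P s"
    unfolding distrib_right[symmetric] by (subst ennreal_plus[symmetric]) simp_all
  finally show ?thesis .
qed

end

section \<open>Second differences and positive semidefinite matrices\<close>

lemma Taylor2:
  fixes \<phi> :: "real \<Rightarrow> real"
  assumes h: "0 < h"
    and d1: "\<And>s. 0 \<le> s \<Longrightarrow> s \<le> h \<Longrightarrow> (\<phi> has_real_derivative \<phi>1 s) (at s)"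
    and d2: "\<And>s. 0 \<le> s \<Longrightarrow> s \<le> h \<Longrightarrow> (\<phi>1 has_real_derivative \<phi>2 s) (at s)"
  shows "\<exists>a. \<bar>a\<bar> \<le> h \<and> \<phi> h = \<phi> 0 + \<phi>1 0 * h + \<phi>2 a * h\<^sup>2 / 2"
proof -
  define diff where "diff m = (if m = 0 then \<phi> else if m = 1 then \<phi>1 else \<phi>2)" for m :: nat
  have "\<exists>t. 0 < t \<and> t < h \<and> \<phi> h = (\<Sum>m<2. diff m 0 / fact m * (h - 0) ^ m) + diff 2 t / fact 2 * (h - 0) ^ 2"
  proof (rule Taylor_up)
    show "\<forall>m t. m < 2 \<and> 0 \<le> t \<and> t \<le> h \<longrightarrow> (diff m has_real_derivative diff (Suc m) t) (at t)"
      using d1 d2 by (auto simp: diff_def less_2_cases_iff)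
  qed (use h in \<open>auto simp: diff_def\<close>)
  then obtain t where "0 < t" "t < h" "\<phi> h = \<phi> 0 + \<phi>1 0 * h + \<phi>2 t * h\<^sup>2 / 2"
    by (auto simp: diff_def numeral_2_eq_2)
  then show ?thesis by (intro exI[of _ t]) simp
qed

text \<open>Adding the Taylor expansions at \<open>h\<close> and \<open>-h\<close> cancels the
  first-order terms. Such quotients stand in for second derivatives of the potential; writing them
  as a mean of two values of \<open>\<phi>2\<close> yields both their bound and their limit.\<close>

lemma second_difference:
  fixes \<phi> :: "real \<Rightarrow> real"
  assumes h: "0 < h"
    and d1: "\<And>s. \<bar>s\<bar> \<le> h \<Longrightarrow> (\<phi> has_real_derivative \<phi>1 s) (at s)"
    and d2: "\<And>s. \<bar>s\<bar> \<le> h \<Longrightarrow> (\<phi>1 has_real_derivative \<phi>2 s) (at s)"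
  shows "\<exists>a b. \<bar>a\<bar> \<le> h \<and> \<bar>b\<bar> \<le> h \<and> (\<phi> h + \<phi> (- h) - 2 * \<phi> 0) / h\<^sup>2 = (\<phi>2 a + \<phi>2 b) / 2"
proof -
  obtain a where a: "\<bar>a\<bar> \<le> h" "\<phi> h = \<phi> 0 + \<phi>1 0 * h + \<phi>2 a * h\<^sup>2 / 2"
    using Taylor2[of h \<phi> \<phi>1 \<phi>2] h d1 d2 by auto
  \<comment> \<open>The expansion at \<open>-h\<close> is that of the reflected function.\<close>
  have "\<exists>b. \<bar>b\<bar> \<le> h \<and> \<phi> (- h) = \<phi> (- 0) + (- \<phi>1 (- 0)) * h + \<phi>2 (- b) * h\<^sup>2 / 2"
  proof (rule Taylor2[of h "\<lambda>s. \<phi> (- s)" "\<lambda>s. - \<phi>1 (- s)" "\<lambda>s. \<phi>2 (- s)"])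
    fix s :: real assume s: "0 \<le> s" "s \<le> h"
    have m: "((\<lambda>s. - s) has_real_derivative -1) (at s)" by (auto intro!: derivative_eq_intros)
    show "((\<lambda>s. \<phi> (- s)) has_real_derivative - \<phi>1 (- s)) (at s)"
      using DERIV_chain2[OF d1[of "- s"] m] s by simp
    show "((\<lambda>s. - \<phi>1 (- s)) has_real_derivative \<phi>2 (- s)) (at s)"
      using DERIV_minus[OF DERIV_chain2[OF d2[of "- s"] m]] s by simp
  qed (rule h)
  then obtain b where b: "\<bar>b\<bar> \<le> h" "\<phi> (- h) = \<phi> 0 - \<phi>1 0 * h + \<phi>2 (- b) * h\<^sup>2 / 2" by auto
  have "\<phi> h + \<phi> (- h) - 2 * \<phi> 0 = (\<phi>2 a + \<phi>2 (- b)) / 2 * h\<^sup>2"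
    unfolding a b by algebra
  then show ?thesis using h a(1) b(1) by (intro exI[of _ a] exI[of _ "- b"]) simp
qed

text \<open>Supplies the dominating constant for limits under the integral sign.\<close>

lemma second_difference_bound:
  fixes \<phi> :: "real \<Rightarrow> real"
  assumes h: "0 < h"
    and d1: "\<And>s. \<bar>s\<bar> \<le> h \<Longrightarrow> (\<phi> has_real_derivative \<phi>1 s) (at s)"
    and d2: "\<And>s. \<bar>s\<bar> \<le> h \<Longrightarrow> (\<phi>1 has_real_derivative \<phi>2 s) (at s)"
    and B: "\<And>s. \<bar>s\<bar> \<le> h \<Longrightarrow> \<bar>\<phi>2 s\<bar> \<le> B"
  shows "\<bar>(\<phi> h + \<phi> (- h) - 2 * \<phi> 0) / h\<^sup>2\<bar> \<le> B"
proof -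
  obtain a b where ab: "\<bar>a\<bar> \<le> h" "\<bar>b\<bar> \<le> h" "(\<phi> h + \<phi> (- h) - 2 * \<phi> 0) / h\<^sup>2 = (\<phi>2 a + \<phi>2 b) / 2"
    using second_difference[of h \<phi> \<phi>1 \<phi>2, OF h d1 d2] by blast
  show ?thesis unfolding ab(3) using B[OF ab(1)] B[OF ab(2)] unfolding abs_le_iff by (simp add: field_simps)
qed

lemma second_difference_tendsto:
  fixes \<phi> :: "real \<Rightarrow> real"
  assumes h0: "0 < h0"
    and d1: "\<And>s. \<bar>s\<bar> \<le> h0 \<Longrightarrow> (\<phi> has_real_derivative \<phi>1 s) (at s)"
    and d2: "\<And>s. \<bar>s\<bar> \<le> h0 \<Longrightarrow> (\<phi>1 has_real_derivative \<phi>2 s) (at s)"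
    and cont: "isCont \<phi>2 0"
    and h: "h \<longlonglongrightarrow> 0" "\<And>n::nat. 0 < h n" "\<And>n. h n \<le> h0"
  shows "(\<lambda>n. (\<phi> (h n) + \<phi> (- h n) - 2 * \<phi> 0) / (h n)\<^sup>2) \<longlonglongrightarrow> \<phi>2 0"
proof (rule LIMSEQ_I)
  fix r :: real assume r: "0 < r"
  obtain d where d: "0 < d" "\<And>s. \<bar>s\<bar> < d \<Longrightarrow> \<bar>\<phi>2 s - \<phi>2 0\<bar> < r"
    using cont r by (auto simp: isCont_def LIM_def dist_real_def) (metis abs_zero diff_self)
  obtain N where N: "\<And>n. N \<le> n \<Longrightarrow> \<bar>h n\<bar> < d"
    using LIMSEQ_D[OF h(1) d(1)] by auto
  show "\<exists>N. \<forall>n\<ge>N. norm ((\<phi> (h n) + \<phi> (- h n) - 2 * \<phi> 0) / (h n)\<^sup>2 - \<phi>2 0) < r"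
  proof (intro exI allI impI)
    fix n assume n: "N \<le> n"
    have "\<exists>a b. \<bar>a\<bar> \<le> h n \<and> \<bar>b\<bar> \<le> h n \<and> (\<phi> (h n) + \<phi> (- h n) - 2 * \<phi> 0) / (h n)\<^sup>2 = (\<phi>2 a + \<phi>2 b) / 2"
      by (rule second_difference[OF h(2)]) (use h(3)[of n] in \<open>auto intro!: d1 d2\<close>)
    then obtain a b where ab: "\<bar>a\<bar> \<le> h n" "\<bar>b\<bar> \<le> h n"
       "(\<phi> (h n) + \<phi> (- h n) - 2 * \<phi> 0) / (h n)\<^sup>2 = (\<phi>2 a + \<phi>2 b) / 2" by blast
    have "\<bar>\<phi>2 a - \<phi>2 0\<bar> < r" "\<bar>\<phi>2 b - \<phi>2 0\<bar> < r" using ab N[OF n] by (auto intro!: d(2))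
    then show "norm ((\<phi> (h n) + \<phi> (- h n) - 2 * \<phi> 0) / (h n)\<^sup>2 - \<phi>2 0) < r"
      unfolding ab(3) real_norm_def abs_less_iff by (simp add: field_simps)
  qed
qed

section \<open>Positive semidefinite matrices as sums of rank-one matrices\<close>

lemma matrix_entry: "(A :: real^'m::finite^'n::finite) $ i $ j = axis i 1 \<bullet> (A *v axis j 1)"
  by (simp add: inner_axis' matrix_vector_mul_component inner_axis)

lemma inner_symmetric_matrix:
  "transpose A = (A :: real^'n::finite^'n) \<Longrightarrow> x \<bullet> (A *v y) = y \<bullet> (A *v x)"
  by (metis dot_lmul_matrix inner_commute transpose_matrix_vector)

lemma psd_Cauchy_Schwarz:
  fixes A :: "real^'n::finite^'n"
  assumes sym: "transpose A = A" and psd: "\<And>x. 0 \<le> x \<bullet> (A *v x)"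
  shows "(x \<bullet> (A *v y))\<^sup>2 \<le> (x \<bullet> (A *v x)) * (y \<bullet> (A *v y))"
proof -
  let ?a = "x \<bullet> (A *v x)" and ?b = "x \<bullet> (A *v y)" and ?c = "y \<bullet> (A *v y)"
  have q: "0 \<le> ?a + 2 * s * ?b + s\<^sup>2 * ?c" for s
    using psd[of "x + s *\<^sub>R y"] inner_symmetric_matrix[OF sym, of y x]
    by (simp add: matrix_vector_right_distrib matrix_vector_mult_scaleR inner_add_left inner_add_right
        power2_eq_square algebra_simps)
  show ?thesis
  proof (cases "?c = 0")
    case True
    have "?b = 0"
    proof (rule ccontr)
      assume "?b \<noteq> 0"
      \<comment> \<open>At this value of \<open>s\<close> the expression in \<open>q\<close> equals
        -1.\<close>
      then have "2 * (- (?a + 1) / (2 * ?b)) * ?b = - (?a + 1)" by simp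
      then show False using q[of "- (?a + 1) / (2 * ?b)"] unfolding True by linarith
    qed
    then show ?thesis by (simp add: True)
  next
    case False
    then have c: "0 < ?c" using psd[of y] by linarith
    \<comment> \<open>The quadratic in \<open>q\<close> is evaluated at its minimum
      \<open>s = - ?b / ?c\<close>.\<close>
    have "0 \<le> ?c * (?a + 2 * (- ?b / ?c) * ?b + (- ?b / ?c)\<^sup>2 * ?c)"
      using q[of "- ?b / ?c"] c by simp
    also have "\<dots> = ?a * ?c - ?b\<^sup>2"
      using c by (simp add: field_simps power2_eq_square)
    finally show ?thesis by simp
  qed
qed

text \<open>Each step of the induction passes to a Schur complement. If the pivot \<open>A $ i $ i\<close> vanishes, then so does
  the \<open>i\<close>-th row, and the division by zero gives the vector \<open>0\<close>.\<close>

lemma psd_sum_rank_one_aux: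
  fixes A :: "real^'n::finite^'n"
  assumes "finite S" "transpose A = A" "\<And>x. 0 \<le> x \<bullet> (A *v x)" "\<And>i j. i \<notin> S \<Longrightarrow> A $ i $ j = 0"
  shows "\<exists>\<xi> :: 'n \<Rightarrow> real^'n. \<forall>i j. A $ i $ j = (\<Sum>k\<in>S. \<xi> k $ i * \<xi> k $ j)"
  using assms
proof (induction S arbitrary: A rule: finite_induct)
  case empty
  then show ?case by simp
next
  case (insert m S)
  note sym = insert.prems(1) and psd = insert.prems(2)
  have symc: "A $ i $ j = A $ j $ i" for i j
    using sym by (metis transpose_def vec_lambda_beta)
  define v where "v = (1 / sqrt (A $ m $ m)) *\<^sub>R (A $ m)"
  define B where "B = (\<chi> i j. A $ i $ j - v $ i * v $ j)"
  have pivot: "0 \<le> A $ m $ m" using psd[of "axis m 1"] by (simp add: matrix_entry)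
  have CS: "((A $ m) \<bullet> x)\<^sup>2 \<le> A $ m $ m * (x \<bullet> (A *v x))" for x
    using psd_Cauchy_Schwarz[OF sym psd, of "axis m 1" x]
    by (simp add: inner_axis' matrix_vector_mul_component inner_axis)
  have vm: "v $ m * v $ j = A $ m $ j" for j
  proof (cases "A $ m $ m = 0")
    case True
    then have "(A $ m $ j)\<^sup>2 \<le> 0" using CS[of "axis j 1"] by (simp add: inner_axis)
    then show ?thesis by (simp add: v_def True)
  qed (use pivot in \<open>simp add: v_def\<close>)
  have Bx: "x \<bullet> (B *v x) = x \<bullet> (A *v x) - (v \<bullet> x)\<^sup>2" for x
    by (simp add: B_def inner_vec_def matrix_vector_mult_def power2_eq_square sum_distrib_left sum_distrib_right
        sum_subtractf algebra_simps)
  have "\<exists>\<xi> :: 'n \<Rightarrow> real^'n. \<forall>i j. B $ i $ j = (\<Sum>k\<in>S. \<xi> k $ i * \<xi> k $ j)"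
  proof (rule insert.IH)
    show "transpose B = B" by (simp add: B_def transpose_def vec_eq_iff symc mult.commute)
    fix x
    \<comment> \<open>Positivity of the Schur complement is the inequality \<open>CS\<close> divided
      by the pivot.\<close>
    have "(v \<bullet> x)\<^sup>2 = ((A $ m) \<bullet> x)\<^sup>2 / A $ m $ m"
      using pivot by (simp add: v_def power_mult_distrib power_divide)
    also have "\<dots> \<le> x \<bullet> (A *v x)"
    proof (cases "A $ m $ m = 0")
      case True then show ?thesis using psd[of x] by simp
    next
      case False then show ?thesis using CS[of x] pivot by (simp add: field_simps)
    qed
    finally show "0 \<le> x \<bullet> (B *v x)" by (simp add: Bx)
  next
    fix i j assume i: "i \<notin> S"
    show "B $ i $ j = 0"
    proof (cases "i = m")
      case True then show ?thesis by (simp add: B_def vm)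
    next
      case False
      then have A0: "A $ i $ l = 0" for l using i insert.prems(3) by blast
      then have "v $ i = 0" by (simp add: v_def symc[of m i])
      then show ?thesis by (simp add: B_def A0)
    qed
  qed
  then obtain \<xi> :: "'n \<Rightarrow> real^'n" where \<xi>: "\<And>i j. B $ i $ j = (\<Sum>k\<in>S. \<xi> k $ i * \<xi> k $ j)" by blast
  have "A $ i $ j = (\<Sum>k\<in>insert m S. (\<xi>(m := v)) k $ i * (\<xi>(m := v)) k $ j)" for i j
  proof -
    have "(\<Sum>k\<in>S. (\<xi>(m := v)) k $ i * (\<xi>(m := v)) k $ j) = B $ i $ j"
      unfolding \<xi> using insert.hyps by (intro sum.cong) auto
    then show ?thesis using insert.hyps by (simp add: B_def)
  qed
  then show ?case by blast
qed

lemma psd_sum_rank_one: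
  fixes A :: "real^'n::finite^'n"
  assumes "transpose A = A" "\<And>x. 0 \<le> x \<bullet> (A *v x)"
  obtains \<xi> :: "'n \<Rightarrow> real^'n" where "\<And>i j. A $ i $ j = (\<Sum>k\<in>UNIV. \<xi> k $ i * \<xi> k $ j)"
  using psd_sum_rank_one_aux[of UNIV A] assms by auto

lemma sum_rank_one_inner:
  fixes A :: "real^'n::finite^'n" and \<xi> :: "'k \<Rightarrow> real^'n"
  assumes "\<And>i j. A $ i $ j = (\<Sum>k\<in>K. \<xi> k $ i * \<xi> k $ j)"
  shows "a \<bullet> (A *v b) = (\<Sum>k\<in>K. (\<xi> k \<bullet> a) * (\<xi> k \<bullet> b))"
proof -
  have "a \<bullet> (A *v b) = (\<Sum>i\<in>UNIV. \<Sum>j\<in>UNIV. \<Sum>k\<in>K. a $ i * (\<xi> k $ i * \<xi> k $ j * b $ j))"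
    by (simp add: inner_vec_def matrix_vector_mult_def assms sum_distrib_left sum_distrib_right)
  also have "\<dots> = (\<Sum>i\<in>UNIV. \<Sum>k\<in>K. \<Sum>j\<in>UNIV. a $ i * (\<xi> k $ i * \<xi> k $ j * b $ j))"
    by (intro sum.cong refl sum.swap)
  also have "\<dots> = (\<Sum>k\<in>K. \<Sum>i\<in>UNIV. \<Sum>j\<in>UNIV. a $ i * (\<xi> k $ i * \<xi> k $ j * b $ j))"
    by (rule sum.swap)
  also have "\<dots> = (\<Sum>k\<in>K. (\<xi> k \<bullet> a) * (\<xi> k \<bullet> b))"
    by (simp add: inner_vec_def sum_product mult_ac)
  finally show ?thesis .
qed

text \<open>With \<open>N\<close> the horizontal Hessian, this writes \<open>LA A u\<close> as a sum
  of second derivatives along the directions \<open>\<xi> k\<close>, which reduces the operator to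
  functions of one variable.\<close>

lemma sum_rank_one_trace:
  fixes A N :: "real^'n::finite^'n" and \<xi> :: "'k \<Rightarrow> real^'n"
  assumes "\<And>i j. A $ i $ j = (\<Sum>k\<in>K. \<xi> k $ i * \<xi> k $ j)"
  shows "trace (A ** N) = (\<Sum>k\<in>K. \<xi> k \<bullet> (N *v \<xi> k))"
proof -
  have "trace (A ** N) = (\<Sum>i\<in>UNIV. \<Sum>j\<in>UNIV. \<Sum>k\<in>K. \<xi> k $ j * (N $ j $ i * \<xi> k $ i))"
    by (simp add: trace_def matrix_matrix_mult_def assms sum_distrib_left sum_distrib_right mult_ac)
  also have "\<dots> = (\<Sum>i\<in>UNIV. \<Sum>k\<in>K. \<Sum>j\<in>UNIV. \<xi> k $ j * (N $ j $ i * \<xi> k $ i))"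
    by (intro sum.cong refl sum.swap)
  also have "\<dots> = (\<Sum>k\<in>K. \<Sum>i\<in>UNIV. \<Sum>j\<in>UNIV. \<xi> k $ j * (N $ j $ i * \<xi> k $ i))"
    by (rule sum.swap)
  also have "\<dots> = (\<Sum>k\<in>K. \<Sum>j\<in>UNIV. \<Sum>i\<in>UNIV. \<xi> k $ j * (N $ j $ i * \<xi> k $ i))"
    by (intro sum.cong refl sum.swap)
  also have "\<dots> = (\<Sum>k\<in>K. \<xi> k \<bullet> (N *v \<xi> k))"
    by (simp add: inner_vec_def matrix_vector_mult_def sum_distrib_left)
  finally show ?thesis .
qed

section \<open>Horizontal derivatives\<close>

text \<open>The integral curve through \<open>z\<close> of the left-invariant horizontal field with
  constant coefficients \<open>\<xi>\<close>. Left translations map such curves to such curves, so a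
  pole can be moved to the origin.\<close>

abbreviation hline :: "'n::finite hpoint \<Rightarrow> real^('n + 'n) \<Rightarrow> real \<Rightarrow> 'n hpoint" where
  "hline z \<xi> s \<equiv> hmul z (s *\<^sub>R \<xi>, 0)"

text \<open>For symmetric \<open>P\<close>, \<open>hform1\<close> and \<open>hform2\<close> are the
  first and second derivatives of \<open>hform P\<close> along \<open>hline\<close>.\<close>

definition hform1 :: "real^('n::finite + 'n)^('n + 'n) \<Rightarrow> 'n hpoint \<Rightarrow> real^('n + 'n) \<Rightarrow> real" where
  "hform1 P w \<xi> = 4 * (fst w \<bullet> (P *v fst w)) * (fst w \<bullet> (P *v \<xi>)) + 4 * snd w * ((Jmat *v fst w) \<bullet> \<xi>)"

definition hform2 :: "real^('n::finite + 'n)^('n + 'n) \<Rightarrow> 'n hpoint \<Rightarrow> real^('n + 'n) \<Rightarrow> real" where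
  "hform2 P w \<xi> = 8 * (fst w \<bullet> (P *v \<xi>))\<^sup>2 + 4 * (fst w \<bullet> (P *v fst w)) * (\<xi> \<bullet> (P *v \<xi>))
     + 8 * ((Jmat *v fst w) \<bullet> \<xi>)\<^sup>2"

text \<open>The kernel as a real function. At the pole \<open>powr\<close> gives the default value
  0, so agreement with \<open>hker\<close> holds only away from it. \<open>rker1\<close> and
  \<open>rker2\<close> are the derivatives along \<open>hline\<close>.\<close>

definition rker :: "real \<Rightarrow> real^('n::finite + 'n)^('n + 'n) \<Rightarrow> 'n hpoint \<Rightarrow> real" where
  "rker b P w = hform P w powr (- b)"

definition rker1 :: "real \<Rightarrow> real^('n::finite + 'n)^('n + 'n) \<Rightarrow> 'n hpoint \<Rightarrow> real^('n + 'n) \<Rightarrow> real" where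
  "rker1 b P w \<xi> = - b * hform P w powr (- b - 1) * hform1 P w \<xi>"

definition rker2 :: "real \<Rightarrow> real^('n::finite + 'n)^('n + 'n) \<Rightarrow> 'n hpoint \<Rightarrow> real^('n + 'n) \<Rightarrow> real" where
  "rker2 b P w \<xi> = b * (b + 1) * hform P w powr (- b - 2) * (hform1 P w \<xi>)\<^sup>2
     - b * hform P w powr (- b - 1) * hform2 P w \<xi>"

lemma fst_hline: "fst (hline w \<xi> s) = fst w + s *\<^sub>R \<xi>"
  and snd_hline: "snd (hline w \<xi> s) = snd w + 2 * s * ((Jmat *v fst w) \<bullet> \<xi>)"
  by (simp_all add: hmul_def)

lemma hmul_zero_right: "hmul w (0, 0) = w"
  by (simp add: hmul_def prod_eq_iff)

text \<open>\<open>Jmat *v \<xi>\<close> is orthogonal to \<open>\<xi>\<close>; hence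
  \<open>t\<close> is affine along \<open>hline\<close>.\<close>

lemma Jmat_hline: "(Jmat *v fst (hline w \<xi> s)) \<bullet> \<xi> = (Jmat *v fst w) \<bullet> \<xi>"
  by (simp add: fst_hline matrix_vector_right_distrib matrix_vector_mult_scaleR inner_add_left inner_Jmat_self)

lemma hline_form:
  assumes "transpose P = P"
  shows "fst (hline w \<xi> s) \<bullet> (P *v fst (hline w \<xi> s)) =
      fst w \<bullet> (P *v fst w) + 2 * s * (fst w \<bullet> (P *v \<xi>)) + s\<^sup>2 * (\<xi> \<bullet> (P *v \<xi>))"
    and "fst (hline w \<xi> s) \<bullet> (P *v \<xi>) = fst w \<bullet> (P *v \<xi>) + s * (\<xi> \<bullet> (P *v \<xi>))"
  using inner_symmetric_matrix[OF assms, of \<xi> "fst w"]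
  by (simp_all add: fst_hline matrix_vector_right_distrib matrix_vector_mult_scaleR inner_add_left inner_add_right
      power2_eq_square algebra_simps)

lemma hform_hline_deriv:
  assumes P: "transpose P = P"
  shows "((\<lambda>s. hform P (hline w \<xi> s)) has_real_derivative hform1 P (hline w \<xi> s) \<xi>) (at s)"
  unfolding hform_def hform1_def hline_form[OF P] snd_hline Jmat_hline
  by (auto intro!: derivative_eq_intros simp: power2_eq_square algebra_simps)

lemma hform1_hline_deriv:
  assumes P: "transpose P = P"
  shows "((\<lambda>s. hform1 P (hline w \<xi> s) \<xi>) has_real_derivative hform2 P (hline w \<xi> s) \<xi>) (at s)"
  unfolding hform1_def hform2_def hline_form[OF P] snd_hline Jmat_hline
  by (auto intro!: derivative_eq_intros simp: power2_eq_square algebra_simps)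

lemma rker_hline_deriv:
  assumes P: "transpose P = P" and pos: "0 < hform P (hline w \<xi> s)"
  shows "((\<lambda>s. rker b P (hline w \<xi> s)) has_real_derivative rker1 b P (hline w \<xi> s) \<xi>) (at s)"
  unfolding rker_def rker1_def
  by (rule derivative_eq_intros hform_hline_deriv[OF P] pos refl | simp)+ 

lemma rker1_hline_deriv:
  assumes P: "transpose P = P" and pos: "0 < hform P (hline w \<xi> s)"
  shows "((\<lambda>s. rker1 b P (hline w \<xi> s) \<xi>) has_real_derivative rker2 b P (hline w \<xi> s) \<xi>) (at s)"
proof -
  have 1: "((\<lambda>s. hform P (hline w \<xi> s) powr (- b - 1)) has_real_derivative
     (- b - 1) * hform P (hline w \<xi> s) powr (- b - 2) * hform1 P (hline w \<xi> s) \<xi>) (at s)"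
    using DERIV_chain2[OF has_real_derivative_powr[OF pos, of "- b - 1"] hform_hline_deriv[OF P]]
    by (simp add: diff_diff_eq)
  show ?thesis unfolding rker1_def rker2_def
    by (rule DERIV_cong[OF DERIV_mult[OF DERIV_cmult[OF 1] hform1_hline_deriv[OF P]]])
       (simp add: algebra_simps power2_eq_square)
qed

lemma continuous_on_rker2:
  assumes "continuous_on S g" "\<And>x. x \<in> S \<Longrightarrow> 0 < hform P (g x)"
  shows "continuous_on S (\<lambda>x. rker2 b P (g x) \<xi>)"
  unfolding rker2_def hform1_def hform2_def
  by (intro continuous_intros assms) (use assms(2) in \<open>auto simp: less_imp_neq[symmetric]\<close>)

lemma continuous_on_rker:
  assumes "continuous_on S g" "\<And>x. x \<in> S \<Longrightarrow> 0 < hform P (g x)"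
  shows "continuous_on S (\<lambda>x. rker b P (g x))"
  unfolding rker_def
  by (intro continuous_intros assms) (use assms(2) in \<open>auto simp: less_imp_neq[symmetric]\<close>)

text \<open>The second derivatives of the kernel, summed over a rank-one decomposition of \<open>A\<close>, all carry the factor
  \<open>q = x \<bullet> Px\<close>; this is what allows \<open>A - A\<^sub>0\<close> to be treated as a perturbation although the operator
  degenerates on the vertical axis.\<close>

definition frozen_grad :: "real^('n::finite + 'n)^('n + 'n) \<Rightarrow> 'n hpoint \<Rightarrow> real^('n + 'n)" where
  "frozen_grad P w = (4 * (fst w \<bullet> (P *v fst w))) *\<^sub>R (P *v fst w) + (4 * snd w) *\<^sub>R (Jmat *v fst w)"

text \<open>This identifies \<open>frozen_grad P w\<close> as the horizontal gradient of
  \<open>hform P\<close> at \<open>w\<close>.\<close>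

lemma hform1_eq_grad:
  assumes "transpose P = P" shows "hform1 P w \<xi> = \<xi> \<bullet> frozen_grad P w"
  using inner_symmetric_matrix[OF assms, of "fst w" \<xi>]
  by (simp add: hform1_def frozen_grad_def inner_add_right inner_commute)

lemma sum_hform1_sq:
  fixes A P :: "real^('n::finite + 'n)^('n + 'n)"
  assumes A: "\<And>i j. A $ i $ j = (\<Sum>k\<in>K. \<xi> k $ i * \<xi> k $ j)" and P: "transpose P = P"
  shows "(\<Sum>k\<in>K. (hform1 P w (\<xi> k))\<^sup>2) = frozen_grad P w \<bullet> (A *v frozen_grad P w)"
  unfolding sum_rank_one_inner[of A \<xi> K, OF A] hform1_eq_grad[OF P] power2_eq_square ..

lemma sum_hform2:
  fixes A P :: "real^('n::finite + 'n)^('n + 'n)"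
  assumes A: "\<And>i j. A $ i $ j = (\<Sum>k\<in>K. \<xi> k $ i * \<xi> k $ j)" and P: "transpose P = P"
  shows "(\<Sum>k\<in>K. hform2 P w (\<xi> k)) = 8 * ((P *v fst w) \<bullet> (A *v (P *v fst w)))
    + 4 * (fst w \<bullet> (P *v fst w)) * trace (A ** P) + 8 * ((Jmat *v fst w) \<bullet> (A *v (Jmat *v fst w)))"
proof -
  have 1: "fst w \<bullet> (P *v \<xi> k) = \<xi> k \<bullet> (P *v fst w)" for k
    by (rule inner_symmetric_matrix[OF P])
  show ?thesis
    unfolding hform2_def sum_rank_one_inner[of A \<xi> K, OF A] sum_rank_one_trace[of A \<xi> K, OF A] 1
    by (simp add: sum.distrib sum_distrib_left power2_eq_square inner_commute mult_ac)
qed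


lemma inner_transpose: "x \<bullet> (transpose B *v y) = (B *v x) \<bullet> (y :: real^'n::finite)"
  by (metis dot_lmul_matrix inner_commute transpose_matrix_vector)

lemma trace_le_if_form_le:
  fixes A :: "real^'n::finite^'n"
  assumes "\<And>x. x \<bullet> (A *v x) \<le> c * (x \<bullet> x)"
  shows "trace A \<le> real CARD('n) * c"
proof -
  have "trace A = (\<Sum>i\<in>UNIV. axis i 1 \<bullet> (A *v axis i 1))" by (simp add: trace_def matrix_entry)
  also have "\<dots> \<le> (\<Sum>i\<in>(UNIV::'n set). c)"
    using assms[of "axis _ 1"] by (intro sum_mono) (simp add: inner_axis_axis)
  finally show ?thesis by simp
qed

text \<open>The operator with coefficients \<open>A0\<close> maps the kernel to \<open>4 b q\<close> times \<open>f\<close> to the power \<open>-b-1\<close>;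
  a perturbation of \<open>A0\<close> of size \<open>c0\<close> costs at most half of this.\<close>

locale frozen =
  fixes A0 :: "real^('n::finite + 'n)^('n + 'n)" and lam Lam b c0 :: real
  assumes lam_pos: "0 < lam" and lam_le: "lam \<le> 1" and Lam_ge: "1 \<le> Lam"
    and sym: "transpose A0 = A0"
    and A0_ge: "lam * (x \<bullet> x) \<le> x \<bullet> (A0 *v x)"
    and A0_le: "x \<bullet> (A0 *v x) \<le> Lam * (x \<bullet> x)"
    and sympl: "A0 ** (transpose Jmat ** A0 ** Jmat) = mat 1"
    and b_def: "b = real (hexp TYPE('n)) / 4"
    and c0_pos: "0 < c0"
    and c0_eq: "c0 * (16 * (b + 2) / lam + 8 * real CARD('n) * Lam) = 2"
begin

abbreviation P :: "real^('n + 'n)^('n + 'n)" where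
  "P \<equiv> transpose Jmat ** A0 ** Jmat"

lemma P_form: "x \<bullet> (P *v y) = (Jmat *v x) \<bullet> (A0 *v (Jmat *v y))"
  by (simp only: matrix_vector_mul_assoc[symmetric] inner_transpose)

lemma P_sym: "transpose P = P"
  by (simp add: matrix_transpose_mul sym matrix_mul_assoc)

text \<open>\<open>Jmat\<close> is orthogonal, so \<open>P\<close> inherits the ellipticity bounds
  of \<open>A0\<close>.\<close>

sublocale hform_bounds P lam Lam
proof
  fix x
  show "lam * (x \<bullet> x) \<le> x \<bullet> (P *v x)" "x \<bullet> (P *v x) \<le> Lam * (x \<bullet> x)"
    unfolding P_form using A0_ge[of "Jmat *v x"] A0_le[of "Jmat *v x"] by (simp_all add: inner_Jmat_Jmat)
qed (rule lam_pos lam_le Lam_ge)+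

lemma A0_P: "A0 *v (P *v x) = x"
  by (simp only: matrix_vector_mul_assoc sympl matrix_vector_mul_lid)

text \<open>Symplecticity enters here: \<open>A0_P\<close> turns \<open>A0 *v (P *v x)\<close> into
  \<open>x\<close> and the mixed terms into multiples of \<open>(Jmat *v x) \<bullet> x = 0\<close>,
  while the definition of \<open>P\<close> makes \<open>Jx \<bullet> A0 Jx\<close> equal to
  \<open>q = x \<bullet> Px\<close>. The sum \<open>16 q^3 + 16 t^2 q\<close> is
  \<open>16 q f\<close>.\<close>

lemma grad_A0: "frozen_grad P w \<bullet> (A0 *v frozen_grad P w) = 16 * (fst w \<bullet> (P *v fst w)) * hform P w"
proof -
  let ?x = "fst w" and ?j = "Jmat *v fst w"
  let ?q = "?x \<bullet> (P *v ?x)"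
  have A0g: "A0 *v frozen_grad P w = (4 * ?q) *\<^sub>R ?x + (4 * snd w) *\<^sub>R (A0 *v ?j)"
    by (simp only: frozen_grad_def matrix_vector_right_distrib matrix_vector_mult_scaleR A0_P)
  have 1: "(P *v ?x) \<bullet> (A0 *v ?j) = 0"
    using inner_symmetric_matrix[OF sym, of "P *v ?x" ?j] by (simp only: A0_P inner_Jmat_self)
  have 2: "(P *v ?x) \<bullet> ?x = ?q" by (rule inner_commute)
  have 3: "?j \<bullet> (A0 *v ?j) = ?q" by (simp only: P_form)
  show ?thesis
    unfolding A0g unfolding frozen_grad_def inner_add_left inner_add_right inner_scaleR_left inner_scaleR_right
      1 2 3 inner_Jmat_self hform_def
    by algebra
qed

lemma trace_A0_P: "trace (A0 ** P) = 2 * real CARD('n)"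
  by (simp only: sympl trace_I) simp

text \<open>For \<open>A = A0\<close> the gradient and Hessian terms combine to
  \<open>(16 b - 8 n) q f = 4 q f\<close>, up to a common positive factor. Every error caused by
  \<open>A - A0\<close> is bounded by a multiple of \<open>q f\<close>, and \<open>c0_eq\<close>
  makes these bounds add up to \<open>2 q f\<close>.\<close>

lemma sum_rker2_ge:
  fixes A :: "real^('n + 'n)^('n + 'n)" and \<xi> :: "'k \<Rightarrow> real^('n + 'n)"
  assumes A: "\<And>i j. A $ i $ j = (\<Sum>k\<in>K. \<xi> k $ i * \<xi> k $ j)"
    and near: "\<And>x. \<bar>x \<bullet> (A *v x) - x \<bullet> (A0 *v x)\<bar> \<le> c0 * (x \<bullet> x)"
    and w: "w \<noteq> 0"
  shows "2 * b * hform P w powr (- b - 1) * (fst w \<bullet> (P *v fst w)) \<le> (\<Sum>k\<in>K. rker2 b P w (\<xi> k))"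
proof -
  let ?x = "fst w" and ?j = "Jmat *v fst w" and ?g = "frozen_grad P w" and ?f = "hform P w"
  let ?N = "real CARD('n)"
  define q where "q = ?x \<bullet> (P *v ?x)"
  have q0: "0 \<le> q" unfolding q_def by (rule form_nonneg)
  have f: "0 < ?f" using w by (rule hform_pos)
  have b: "0 < b" using hexp_ge[where 'n = 'n] by (simp add: b_def)
  note c0 = c0_pos
  \<comment> \<open>Ellipticity of \<open>A0\<close> bounds the squared Euclidean length of the
    gradient by \<open>16 q f / lam\<close>, so the error keeps the factor \<open>q\<close>.\<close>
  have g: "?g \<bullet> (A *v ?g) \<ge> 16 * q * ?f - c0 * (16 * q * ?f / lam)"
  proof -
    have "?g \<bullet> ?g \<le> 16 * q * ?f / lam"
      using A0_ge[of ?g] lam_pos unfolding grad_A0 q_def by (simp add: field_simps)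
    then have "c0 * (?g \<bullet> ?g) \<le> c0 * (16 * q * ?f / lam)" using c0 by (intro mult_left_mono) simp_all
    then show ?thesis using near[of ?g] unfolding grad_A0 q_def[symmetric] abs_le_iff by linarith
  qed
  have p: "(P *v ?x) \<bullet> (A *v (P *v ?x)) \<le> q + c0 * (q / lam)"
  proof -
    have eq: "(P *v ?x) \<bullet> (A0 *v (P *v ?x)) = q" by (simp only: A0_P q_def inner_commute)
    have "(P *v ?x) \<bullet> (P *v ?x) \<le> q / lam"
      using A0_ge[of "P *v ?x"] lam_pos unfolding eq by (simp add: field_simps)
    then have "c0 * ((P *v ?x) \<bullet> (P *v ?x)) \<le> c0 * (q / lam)" using c0 by (intro mult_left_mono) simp_all
    then show ?thesis using near[of "P *v ?x"] unfolding eq abs_le_iff by linarith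
  qed
  have j: "?j \<bullet> (A *v ?j) \<le> q + c0 * (q / lam)"
  proof -
    have eq: "?j \<bullet> (A0 *v ?j) = q" by (simp only: P_form q_def)
    have "?j \<bullet> ?j \<le> q / lam"
      using A0_ge[of ?j] lam_pos unfolding eq by (simp add: field_simps)
    then have "c0 * (?j \<bullet> ?j) \<le> c0 * (q / lam)" using c0 by (intro mult_left_mono) simp_all
    then show ?thesis using near[of ?j] unfolding eq abs_le_iff by linarith
  qed
  have t: "trace (A ** P) \<le> 2 * ?N + c0 * (2 * ?N * Lam)"
  proof -
    \<comment> \<open>Decomposing \<open>P\<close> instead of \<open>A\<close> allows
      \<open>near\<close> to be applied to the trace term by term.\<close>
    obtain p :: "('n + 'n) \<Rightarrow> real^('n + 'n)" where p: "\<And>i j. P $ i $ j = (\<Sum>k\<in>UNIV. p k $ i * p k $ j)"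
      using psd_sum_rank_one[OF P_sym form_nonneg] by blast
    have "trace (A ** P) = trace (P ** A)" by (rule trace_mul_sym)
    also have "\<dots> = (\<Sum>k\<in>UNIV. p k \<bullet> (A *v p k))" by (rule sum_rank_one_trace[OF p])
    also have "\<dots> \<le> (\<Sum>k\<in>UNIV. p k \<bullet> (A0 *v p k) + c0 * (p k \<bullet> (mat 1 *v p k)))"
      using near unfolding abs_le_iff matrix_vector_mul_lid by (intro sum_mono) (simp add: algebra_simps)
    also have "\<dots> = trace (P ** A0) + c0 * trace (P ** mat 1)"
      unfolding sum.distrib sum_distrib_left[symmetric] sum_rank_one_trace[OF p] ..
    also have "trace (P ** A0) = 2 * ?N" using trace_A0_P trace_mul_sym[of A0 P] by simp
    also have "c0 * trace (P ** mat 1) \<le> c0 * (2 * ?N * Lam)"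
    proof (intro mult_left_mono)
      show "trace (P ** mat 1) \<le> 2 * ?N * Lam"
        using trace_le_if_form_le[OF form_le] by (simp only: matrix_mul_rid) simp
    qed (use c0 in simp)
    finally show ?thesis by simp
  qed
  have h2: "(\<Sum>k\<in>K. hform2 P w (\<xi> k)) \<le> 16 * (q + c0 * (q / lam)) + 4 * q * (2 * ?N + c0 * (2 * ?N * Lam))"
  proof -
    have "8 * ((P *v ?x) \<bullet> (A *v (P *v ?x))) + 4 * q * trace (A ** P) + 8 * (?j \<bullet> (A *v ?j))
        \<le> 8 * (q + c0 * (q / lam)) + 4 * q * (2 * ?N + c0 * (2 * ?N * Lam)) + 8 * (q + c0 * (q / lam))"
      by (intro add_mono mult_left_mono p j t) (use q0 in simp_all)
    then show ?thesis
      unfolding sum_hform2[of A \<xi> K, OF A P_sym] q_def[symmetric] by simp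
  qed
  have split: "?f powr (- b - 1) = ?f powr (- b - 2) * ?f"
  proof -
    have "- b - 1 = (- b - 2) + 1" by simp
    then show ?thesis using f by (simp only: powr_add powr_one)
  qed
  \<comment> \<open>The surplus 4 is due to the exponent: for the fundamental solution,
    \<open>b = (Q-2)/4\<close>, the difference would be 0.\<close>
  have b_eq: "16 * b - 8 * ?N = 4" by (simp add: b_def hexp_def field_simps)
  have "2 * q * ?f = q * ?f * (4 - c0 * (16 * (b + 2) / lam + 8 * ?N * Lam))" unfolding c0_eq by simp
  also have "\<dots> = q * ?f * ((16 * b - 8 * ?N) - c0 * (16 * (b + 2) / lam + 8 * ?N * Lam))"
    by (simp only: b_eq)
  also have "\<dots> = (b + 1) * (16 * q * ?f - c0 * (16 * q * ?f / lam))
     - ?f * (16 * (q + c0 * (q / lam)) + 4 * q * (2 * ?N + c0 * (2 * ?N * Lam)))"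
    using lam_pos by (simp add: field_simps)
  also have "\<dots> \<le> (b + 1) * (?g \<bullet> (A *v ?g)) - ?f * (\<Sum>k\<in>K. hform2 P w (\<xi> k))"
    using b f by (intro diff_mono mult_left_mono g h2) simp_all
  finally have main: "2 * q * ?f \<le> (b + 1) * (?g \<bullet> (A *v ?g)) - ?f * (\<Sum>k\<in>K. hform2 P w (\<xi> k))" .
  have "(\<Sum>k\<in>K. rker2 b P w (\<xi> k)) = b * (b + 1) * ?f powr (- b - 2) * (\<Sum>k\<in>K. (hform1 P w (\<xi> k))\<^sup>2)
      - b * ?f powr (- b - 1) * (\<Sum>k\<in>K. hform2 P w (\<xi> k))"
    by (simp only: rker2_def sum_subtractf sum_distrib_left)
  also have "\<dots> = b * ?f powr (- b - 2) * ((b + 1) * (?g \<bullet> (A *v ?g)) - ?f * (\<Sum>k\<in>K. hform2 P w (\<xi> k)))"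
    unfolding sum_hform1_sq[of A \<xi> K, OF A P_sym] split by algebra
  also have "\<dots> \<ge> b * ?f powr (- b - 2) * (2 * q * ?f)"
    using b by (intro mult_left_mono main) simp
  finally show ?thesis unfolding split q_def[symmetric] by (simp only: mult_ac)
qed

end

section \<open>Differentiating the potential\<close>

lemma integral_tendsto_on_compact:
  fixes g :: "nat \<Rightarrow> 'a::euclidean_space \<Rightarrow> real"
  assumes H: "compact H"
    and cont: "\<And>n. continuous_on H (g n)" "continuous_on H g'"
    and lim: "\<And>x. x \<in> H \<Longrightarrow> (\<lambda>n. g n x) \<longlonglongrightarrow> g' x"
    and bound: "\<And>n x. x \<in> H \<Longrightarrow> \<bar>g n x\<bar> \<le> B"
  shows "(\<lambda>n. \<integral>x. indicator H x *\<^sub>R g n x \<partial>lborel) \<longlonglongrightarrow> (\<integral>x. indicator H x *\<^sub>R g' x \<partial>lborel)"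
proof (rule integral_dominated_convergence[where w = "\<lambda>x. indicator H x *\<^sub>R B"])
  show "integrable lborel (\<lambda>x. indicator H x *\<^sub>R B)"
    by (intro borel_integrable_compact H continuous_intros)
  show "(\<lambda>x. indicator H x *\<^sub>R g' x) \<in> borel_measurable lborel"
    by (rule borel_measurable_integrable[OF borel_integrable_compact[OF H cont(2)]])
  show "(\<lambda>x. indicator H x *\<^sub>R g n x) \<in> borel_measurable lborel" for n
    by (rule borel_measurable_integrable[OF borel_integrable_compact[OF H cont(1)]])
  show "AE x in lborel. (\<lambda>n. indicator H x *\<^sub>R g n x) \<longlonglongrightarrow> indicator H x *\<^sub>R g' x"
    using lim by (intro AE_I2) (simp add: indicator_def)
  show "AE x in lborel. norm (indicator H x *\<^sub>R g n x) \<le> indicator H x *\<^sub>R B" for n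
    using bound by (intro AE_I2) (simp add: indicator_def)
qed

lemma hmul_hinv_eq_0: "hmul (hinv \<zeta>) z = 0 \<longleftrightarrow> \<zeta> = z"
proof
  assume "hmul (hinv \<zeta>) z = 0"
  then have "z = hmul \<zeta> 0" using hmul_hinv_cancel[of \<zeta> z] by simp
  then show "\<zeta> = z" by (simp add: hmul_def prod_eq_iff)
qed (simp add: hmul_def hinv_def prod_eq_iff matrix_vector_mult_minus inner_Jmat_self)

context frozen
begin

text \<open>Real-valued counterpart of \<open>fpot\<close>, suited to difference quotients; the two
  agree off a compact \<open>H\<close>.\<close>

definition rpot :: "'n hpoint set \<Rightarrow> 'n hpoint \<Rightarrow> real" where
  "rpot H z = (\<integral>\<zeta>. indicator H \<zeta> *\<^sub>R rker b P (hmul (hinv \<zeta>) z) \<partial>lborel)"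

lemma b_pos: "0 < b"
  using hexp_ge[where 'n = 'n] by (simp add: b_def)

lemma hform_pole_pos: "z \<notin> H \<Longrightarrow> \<zeta> \<in> H \<Longrightarrow> 0 < hform P (hmul (hinv \<zeta>) z)"
  using hmul_hinv_eq_0[of \<zeta> z] by (intro hform_pos) auto

lemma continuous_on_pole:
  assumes z: "z \<notin> H"
  shows "continuous_on H (\<lambda>\<zeta>. rker b P (hmul (hinv \<zeta>) z))"
    and "continuous_on H (\<lambda>\<zeta>. rker2 b P (hmul (hinv \<zeta>) z) \<xi>)"
  by (intro continuous_on_rker continuous_on_rker2 continuous_intros hform_pole_pos[OF z]; assumption)+

lemma hker_eq_rker:
  assumes "w \<noteq> 0" shows "hker P w = ennreal (rker b P w)"
  using hform_pos[OF assms] unfolding hker_def rker_def b_def powr_minus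
  by (subst inverse_ennreal) simp_all

lemma fpot_eq_rpot:
  assumes H: "compact H" and z: "z \<notin> H"
  shows "fpot P H z = ennreal (rpot H z)"
proof -
  have "fpot P H z = (\<integral>\<^sup>+\<zeta>. ennreal (indicator H \<zeta> *\<^sub>R rker b P (hmul (hinv \<zeta>) z)) \<partial>lborel)"
    unfolding fpot_def
  proof (intro nn_integral_cong)
    fix \<zeta>
    show "hker P (hmul (hinv \<zeta>) z) * indicator H \<zeta> = ennreal (indicator H \<zeta> *\<^sub>R rker b P (hmul (hinv \<zeta>) z))"
      using z hmul_hinv_eq_0[of \<zeta> z] by (cases "\<zeta> \<in> H") (auto simp: hker_eq_rker)
  qed
  also have "\<dots> = ennreal (rpot H z)"
    unfolding rpot_def
    by (intro nn_integral_eq_integral borel_integrable_compact H continuous_on_pole z AE_I2)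
       (simp add: rker_def)
  finally show ?thesis .
qed

text \<open>Near \<open>z\<close> the kernel is bounded uniformly over the poles in
  \<open>H\<close>, so dominated convergence applies.\<close>

lemma rpot_tendsto:
  assumes H: "compact H" and z: "z \<notin> H" and y: "y \<longlonglongrightarrow> z"
  shows "(\<lambda>n. rpot H (y n)) \<longlonglongrightarrow> rpot H z"
proof -
  have "open (- H)" using H compact_imp_closed by blast
  then obtain e where e: "0 < e" "cball z e \<subseteq> - H"
    using z open_contains_cball by blast
  have pos: "0 < hform P (hmul (hinv \<zeta>) w)" if "\<zeta> \<in> H" "w \<in> cball z e" for \<zeta> w
    using that e(2) by (intro hform_pole_pos[of w H]) auto
  have "continuous_on (H \<times> cball z e) (\<lambda>p. rker b P (hmul (hinv (fst p)) (snd p)))"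
    by (intro continuous_on_rker continuous_intros) (auto intro!: pos)
  then have "compact ((\<lambda>p. rker b P (hmul (hinv (fst p)) (snd p))) ` (H \<times> cball z e))"
    by (intro compact_continuous_image compact_Times H compact_cball)
  from compact_imp_bounded[OF this] obtain B
    where B': "\<And>p. p \<in> H \<times> cball z e \<Longrightarrow> norm (rker b P (hmul (hinv (fst p)) (snd p))) \<le> B"
    unfolding bounded_iff by blast
  have B: "\<bar>rker b P (hmul (hinv \<zeta>) w)\<bar> \<le> B" if "\<zeta> \<in> H" "w \<in> cball z e" for \<zeta> w
    using B'[of "(\<zeta>, w)"] that by simp
  obtain N where N: "\<And>n. N \<le> n \<Longrightarrow> y n \<in> cball z e"
    using metric_LIMSEQ_D[OF y e(1)] by (auto simp: dist_commute) (meson less_imp_le)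
  \<comment> \<open>The shift by \<open>N\<close> puts all terms into the closed ball on which
    \<open>B\<close> is valid.\<close>
  have "(\<lambda>n. rpot H (y (n + N))) \<longlonglongrightarrow> rpot H z"
    unfolding rpot_def
  proof (rule integral_tendsto_on_compact[OF H])
    show "continuous_on H (\<lambda>\<zeta>. rker b P (hmul (hinv \<zeta>) (y (n + N))))" for n
      using N[of "n + N"] e(2) by (intro continuous_on_pole) auto
    show "continuous_on H (\<lambda>\<zeta>. rker b P (hmul (hinv \<zeta>) z))"
      by (rule continuous_on_pole[OF z])
    show "\<bar>rker b P (hmul (hinv \<zeta>) (y (n + N)))\<bar> \<le> B" if "\<zeta> \<in> H" for n \<zeta>
      by (rule B[OF that N]) simp
    fix \<zeta> assume \<zeta>: "\<zeta> \<in> H"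
    have "continuous_on (cball z e) (\<lambda>w. rker b P (hmul (hinv \<zeta>) w))"
      using pos[OF \<zeta>] by (intro continuous_on_rker continuous_intros) auto
    then show "(\<lambda>n. rker b P (hmul (hinv \<zeta>) (y (n + N)))) \<longlonglongrightarrow> rker b P (hmul (hinv \<zeta>) z)"
      by (rule continuous_on_tendsto_compose)
         (use e N LIMSEQ_ignore_initial_segment[OF y, of N] in \<open>auto simp: eventually_sequentially\<close>)
  qed
  then show ?thesis by (rule LIMSEQ_offset)
qed

text \<open>Differentiation under the integral sign: the segment avoids the compact set
  \<open>H\<close>, so the second derivatives of the kernel along it are bounded uniformly in the
  pole, and with them the difference quotients.\<close>

lemma rpot_second_difference:
  assumes H: "compact H" and h0: "0 < h0" and off: "\<And>s. \<bar>s\<bar> \<le> h0 \<Longrightarrow> hline z \<xi> s \<notin> H"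
    and h: "h \<longlonglongrightarrow> 0" "\<And>n::nat. 0 < h n" "\<And>n. h n \<le> h0"
  shows "(\<lambda>n. (rpot H (hline z \<xi> (h n)) + rpot H (hline z \<xi> (- h n)) - 2 * rpot H z) / (h n)\<^sup>2)
    \<longlonglongrightarrow> (\<integral>\<zeta>. indicator H \<zeta> *\<^sub>R rker2 b P (hmul (hinv \<zeta>) z) \<xi> \<partial>lborel)"
proof -
  define \<phi> where "\<phi> \<zeta> s = rker b P (hmul (hinv \<zeta>) (hline z \<xi> s))" for \<zeta> s
  define \<phi>1 where "\<phi>1 \<zeta> s = rker1 b P (hmul (hinv \<zeta>) (hline z \<xi> s)) \<xi>" for \<zeta> s
  define \<phi>2 where "\<phi>2 \<zeta> s = rker2 b P (hmul (hinv \<zeta>) (hline z \<xi> s)) \<xi>" for \<zeta> s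
  have z: "z \<notin> H" using off[of 0] h0 by (simp add: hmul_zero_right)
  have pos: "0 < hform P (hmul (hinv \<zeta>) (hline z \<xi> s))" if "\<zeta> \<in> H" "\<bar>s\<bar> \<le> h0" for \<zeta> s
    using that off by (intro hform_pole_pos) auto
  \<comment> \<open>Associativity turns the translate by \<open>hinv \<zeta>\<close> of the line
    through \<open>z\<close> into the horizontal line through
    \<open>hmul (hinv \<zeta>) z\<close>.\<close>
  have d1: "(\<phi> \<zeta> has_real_derivative \<phi>1 \<zeta> s) (at s)" if "\<zeta> \<in> H" "\<bar>s\<bar> \<le> h0" for \<zeta> s
    using pos[OF that] unfolding \<phi>_def \<phi>1_def hmul_assoc[symmetric] by (rule rker_hline_deriv[OF P_sym])
  have d2: "(\<phi>1 \<zeta> has_real_derivative \<phi>2 \<zeta> s) (at s)" if "\<zeta> \<in> H" "\<bar>s\<bar> \<le> h0" for \<zeta> s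
    using pos[OF that] unfolding \<phi>1_def \<phi>2_def hmul_assoc[symmetric] by (rule rker1_hline_deriv[OF P_sym])
  have "continuous_on (H \<times> {- h0..h0}) (\<lambda>p. \<phi>2 (fst p) (snd p))"
    unfolding \<phi>2_def by (intro continuous_on_rker2 continuous_intros) (auto intro!: pos)
  then have cpt: "compact ((\<lambda>p. \<phi>2 (fst p) (snd p)) ` (H \<times> {- h0..h0}))"
    by (intro compact_continuous_image compact_Times H compact_Icc)
  obtain B where B': "\<And>p. p \<in> H \<times> {- h0..h0} \<Longrightarrow> norm (\<phi>2 (fst p) (snd p)) \<le> B"
    using compact_imp_bounded[OF cpt] unfolding bounded_iff by blast
  have B: "\<bar>\<phi>2 \<zeta> s\<bar> \<le> B" if "\<zeta> \<in> H" "\<bar>s\<bar> \<le> h0" for \<zeta> s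
    using B'[of "(\<zeta>, s)"] that by (auto simp: abs_le_iff)
  have int: "rpot H (hline z \<xi> s) = (\<integral>\<zeta>. indicator H \<zeta> *\<^sub>R \<phi> \<zeta> s \<partial>lborel)" for s
    unfolding rpot_def \<phi>_def ..
  have int0: "rpot H z = (\<integral>\<zeta>. indicator H \<zeta> *\<^sub>R \<phi> \<zeta> 0 \<partial>lborel)"
    using int[of 0] by (simp add: hmul_zero_right)
  have cont: "continuous_on H (\<lambda>\<zeta>. \<phi> \<zeta> s)" if "\<bar>s\<bar> \<le> h0" for s
    unfolding \<phi>_def by (rule continuous_on_pole(1)[OF off[OF that]])
  have integ: "integrable lborel (\<lambda>\<zeta>. indicator H \<zeta> *\<^sub>R \<phi> \<zeta> s)" if "\<bar>s\<bar> \<le> h0" for s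
    by (rule borel_integrable_compact[OF H cont[OF that]])
  have hs: "\<bar>h n\<bar> \<le> h0" "\<bar>- h n\<bar> \<le> h0" for n using h(2,3)[of n] by simp_all
  have quot: "(rpot H (hline z \<xi> (h n)) + rpot H (hline z \<xi> (- h n)) - 2 * rpot H z) / (h n)\<^sup>2 =
     (\<integral>\<zeta>. indicator H \<zeta> *\<^sub>R ((\<phi> \<zeta> (h n) + \<phi> \<zeta> (- h n) - 2 * \<phi> \<zeta> 0) / (h n)\<^sup>2) \<partial>lborel)" for n
  proof -
    let ?I = "\<lambda>s \<zeta>. indicator H \<zeta> *\<^sub>R \<phi> \<zeta> s"
    have i0: "integrable lborel (?I 0)" using integ[of 0] h0 by simp
    have "(\<integral>\<zeta>. indicator H \<zeta> *\<^sub>R ((\<phi> \<zeta> (h n) + \<phi> \<zeta> (- h n) - 2 * \<phi> \<zeta> 0) / (h n)\<^sup>2) \<partial>lborel) =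
      (\<integral>\<zeta>. (?I (h n) \<zeta> + ?I (- h n) \<zeta> - 2 * ?I 0 \<zeta>) / (h n)\<^sup>2 \<partial>lborel)"
      by (intro Bochner_Integration.integral_cong) (simp_all add: algebra_simps diff_divide_distrib add_divide_distrib)
    also have "\<dots> = ((\<integral>\<zeta>. ?I (h n) \<zeta> \<partial>lborel) + (\<integral>\<zeta>. ?I (- h n) \<zeta> \<partial>lborel) - 2 * (\<integral>\<zeta>. ?I 0 \<zeta> \<partial>lborel)) / (h n)\<^sup>2"
      using integ[OF hs(1)[of n]] integ[OF hs(2)[of n]] i0
      by (simp only: integral_divide_zero Bochner_Integration.integral_diff Bochner_Integration.integral_add
         integral_mult_right_zero Bochner_Integration.integrable_add integrable_mult_right)
    finally show ?thesis by (simp only: int int0)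
  qed
  show ?thesis
    unfolding quot
  proof (rule integral_tendsto_on_compact[OF H])
    show "continuous_on H (\<lambda>\<zeta>. (\<phi> \<zeta> (h n) + \<phi> \<zeta> (- h n) - 2 * \<phi> \<zeta> 0) / (h n)\<^sup>2)" for n
      using h0 h(2)[of n] by (intro continuous_intros cont hs) auto
    show "continuous_on H (\<lambda>\<zeta>. rker2 b P (hmul (hinv \<zeta>) z) \<xi>)"
      by (rule continuous_on_pole(2)[OF z])
    fix \<zeta> assume \<zeta>: "\<zeta> \<in> H"
    have "continuous_on {- h0<..<h0} (\<phi>2 \<zeta>)"
      unfolding \<phi>2_def using pos[OF \<zeta>] by (intro continuous_on_rker2 continuous_intros) auto
    then have "isCont (\<phi>2 \<zeta>) 0" using h0 by (simp add: continuous_on_eq_continuous_at)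
    then have "(\<lambda>n. (\<phi> \<zeta> (h n) + \<phi> \<zeta> (- h n) - 2 * \<phi> \<zeta> 0) / (h n)\<^sup>2) \<longlonglongrightarrow> \<phi>2 \<zeta> 0"
      by (intro second_difference_tendsto[OF h0 d1[OF \<zeta>] d2[OF \<zeta>] _ h])
    then show "(\<lambda>n. (\<phi> \<zeta> (h n) + \<phi> \<zeta> (- h n) - 2 * \<phi> \<zeta> 0) / (h n)\<^sup>2) \<longlonglongrightarrow> rker2 b P (hmul (hinv \<zeta>) z) \<xi>"
      by (simp add: \<phi>2_def hmul_zero_right)
    fix n
    show "\<bar>(\<phi> \<zeta> (h n) + \<phi> \<zeta> (- h n) - 2 * \<phi> \<zeta> 0) / (h n)\<^sup>2\<bar> \<le> B"
    proof (rule second_difference_bound[OF h(2)])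
      fix s assume "\<bar>s\<bar> \<le> h n"
      then have s: "\<bar>s\<bar> \<le> h0" using h(3)[of n] by linarith
      show "(\<phi> \<zeta> has_real_derivative \<phi>1 \<zeta> s) (at s)" by (rule d1[OF \<zeta> s])
      show "(\<phi>1 \<zeta> has_real_derivative \<phi>2 \<zeta> s) (at s)" by (rule d2[OF \<zeta> s])
      show "\<bar>\<phi>2 \<zeta> s\<bar> \<le> B" by (rule B[OF \<zeta> s])
    qed
  qed
qed

text \<open>The integrand is at least a positive multiple of \<open>q\<close>, which vanishes only
  for poles on the vertical line through \<open>z\<close>, a null set. The strict sign is what the
  maximum principle uses, despite the degeneracy of the pointwise bound.\<close>

lemma integral_sum_rker2_pos:
  fixes A :: "real^('n + 'n)^('n + 'n)" and \<xi> :: "'k \<Rightarrow> real^('n + 'n)"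
  assumes A: "\<And>i j. A $ i $ j = (\<Sum>k\<in>K. \<xi> k $ i * \<xi> k $ j)"
    and near: "\<And>x. \<bar>x \<bullet> (A *v x) - x \<bullet> (A0 *v x)\<bar> \<le> c0 * (x \<bullet> x)"
    and H: "compact H" and z: "z \<notin> H" and Hpos: "0 < emeasure lborel H"
  shows "0 < (\<integral>\<zeta>. indicator H \<zeta> *\<^sub>R (\<Sum>k\<in>K. rker2 b P (hmul (hinv \<zeta>) z) (\<xi> k)) \<partial>lborel)"
proof -
  let ?S = "\<lambda>\<zeta>. indicator H \<zeta> *\<^sub>R (\<Sum>k\<in>K. rker2 b P (hmul (hinv \<zeta>) z) (\<xi> k))"
  let ?q = "\<lambda>\<zeta>. fst (hmul (hinv \<zeta>) z) \<bullet> (P *v fst (hmul (hinv \<zeta>) z))"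
  let ?l = "\<lambda>\<zeta>. 2 * b * hform P (hmul (hinv \<zeta>) z) powr (- b - 1) * ?q \<zeta>"
  have ne: "hmul (hinv \<zeta>) z \<noteq> 0" if "\<zeta> \<in> H" for \<zeta> using that z hmul_hinv_eq_0[of \<zeta> z] by auto
  have le: "?l \<zeta> \<le> ?S \<zeta>" if "\<zeta> \<in> H" for \<zeta>
    using sum_rker2_ge[OF A near ne[OF that]] that by simp
  have l0: "0 \<le> ?l \<zeta>" for \<zeta> using b_pos form_nonneg by (intro mult_nonneg_nonneg) simp_all
  have S0: "0 \<le> ?S \<zeta>" for \<zeta> using le[of \<zeta>] l0[of \<zeta>] by (cases "\<zeta> \<in> H") auto
  have integ: "integrable lborel ?S"
    by (intro borel_integrable_compact H continuous_on_sum continuous_on_pole z)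
  have "(\<integral>\<zeta>. ?S \<zeta> \<partial>lborel) \<noteq> 0"
  proof
    assume "(\<integral>\<zeta>. ?S \<zeta> \<partial>lborel) = 0"
    then have "AE \<zeta> in lborel. ?S \<zeta> = 0"
      using integral_nonneg_eq_0_iff_AE[OF integ] S0 by simp
    moreover have "\<zeta> \<notin> H \<or> fst \<zeta> = fst z" if "?S \<zeta> = 0" for \<zeta>
    proof (rule ccontr)
      assume "\<not> (\<zeta> \<notin> H \<or> fst \<zeta> = fst z)"
      then have \<zeta>: "\<zeta> \<in> H" "fst (hmul (hinv \<zeta>) z) \<noteq> 0" by (auto simp: hmul_def hinv_def)
      have "0 < lam * (fst (hmul (hinv \<zeta>) z) \<bullet> fst (hmul (hinv \<zeta>) z))"
        using lam_pos \<zeta>(2) by (intro mult_pos_pos) (simp_all only: inner_gt_zero_iff not_False_eq_True)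
      then have "0 < ?q \<zeta>" using form_ge less_le_trans by blast
      then have "0 < ?l \<zeta>" using b_pos hform_pos[OF ne[OF \<zeta>(1)]] by (intro mult_pos_pos) auto
      then show False using le[OF \<zeta>(1)] that by linarith
    qed
    ultimately have "AE \<zeta> in lborel. \<zeta> \<notin> H \<or> fst \<zeta> = fst z" by (rule eventually_mono)
    moreover have "AE \<zeta>::'n hpoint in lborel. fst \<zeta> \<noteq> fst z"
    proof (rule AE_I[where N = "{w::'n hpoint. fst w = fst z}"])
      show "emeasure lborel {w::'n hpoint. fst w = fst z} = 0" by (rule emeasure_fst_eq)
      have "closed {w::'n hpoint. fst w = fst z}" by (intro closed_Collect_eq continuous_intros)
      then show "{w::'n hpoint. fst w = fst z} \<in> sets lborel" by simp
    qed auto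
    ultimately have "AE \<zeta> in lborel. \<zeta> \<notin> H" by eventually_elim auto
    then have "emeasure lborel H = 0"
      using H by (subst (asm) AE_iff_measurable[where N = H]) (auto simp: compact_imp_closed)
    with Hpos show False by simp
  qed
  moreover have "0 \<le> (\<integral>\<zeta>. ?S \<zeta> \<partial>lborel)" using S0 by (rule Bochner_Integration.integral_nonneg)
  ultimately show ?thesis by linarith
qed

end


section \<open>Second differences of a C^2 function along horizontal lines\<close>

lemma hfield_deriv:
  "((\<lambda>y. hfield j y) has_derivative (\<lambda>v. (0, 2 * (Jmat *v fst v) $ j))) (at z)"
  unfolding hfield_def
  by (auto intro!: derivative_eq_intros has_derivative_Pair bounded_linear.has_derivative[OF bounded_linear_vec_nth]
      bounded_linear.has_derivative[OF matrix_vector_mul_bounded_linear] bounded_linear.has_derivative[OF bounded_linear_fst])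

lemma hline_eq: "hline z \<xi> s = z + s *\<^sub>R (\<xi>, 2 * ((Jmat *v fst z) \<bullet> \<xi>))"
  by (simp add: hmul_def prod_eq_iff)

lemma sum_hfield: "(\<Sum>i\<in>UNIV. \<xi> $ i *\<^sub>R hfield i z) = (\<xi>, 2 * ((Jmat *v fst z) \<bullet> \<xi>))"
proof -
  have "(\<Sum>i\<in>UNIV. \<xi> $ i *\<^sub>R axis i (1::real)) = \<xi>" using basis_expansion[of \<xi>] by (simp add: scalar_mult_eq_scaleR)
  then show ?thesis
    by (simp add: hfield_def prod_eq_iff fst_sum snd_sum inner_vec_def sum_distrib_left mult_ac)
qed

text \<open>Differentiating the coefficients of \<open>hfield j\<close> along
  \<open>hfield i\<close> adds the value of \<open>Du z\<close> at
  \<open>(0, 2 * Jmat $ j $ i)\<close>. This is antisymmetric in \<open>i\<close> and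
  \<open>j\<close>, so the symmetrisation in \<open>hhess\<close> removes it.\<close>

lemma inner_hhess:
  fixes u :: "'n::finite hpoint \<Rightarrow> real"
  assumes S: "open S" "z \<in> S"
    and D1: "\<And>y. y \<in> S \<Longrightarrow> (u has_derivative blinfun_apply (Du y)) (at y)"
    and D2: "(Du has_derivative blinfun_apply D2) (at z)"
  shows "\<xi> \<bullet> (hhess u z *v \<xi>) =
    blinfun_apply (blinfun_apply D2 (\<xi>, 2 * ((Jmat *v fst z) \<bullet> \<xi>))) (\<xi>, 2 * ((Jmat *v fst z) \<bullet> \<xi>))"
proof -
  let ?X = "\<lambda>i. hfield i z"
  have X1: "Xd j u y = blinfun_apply (Du y) (hfield j y)" if "y \<in> S" for j y
    unfolding Xd_def using frechet_derivative_at[OF D1[OF that]] by simp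
  have X2: "Xd i (Xd j u) z = blinfun_apply (blinfun_apply D2 (?X i)) (?X j) + blinfun_apply (Du z) (0, 2 * (Jmat $ j $ i))" for i j
  proof -
    have "((\<lambda>y. blinfun_apply (Du y) (hfield j y)) has_derivative
        (\<lambda>v. blinfun_apply (Du z) (0, 2 * (Jmat *v fst v) $ j) + blinfun_apply (blinfun_apply D2 v) (?X j))) (at z)"
      by (rule bounded_bilinear.FDERIV[OF bounded_bilinear_blinfun_apply D2 hfield_deriv])
    then have "(Xd j u has_derivative
        (\<lambda>v. blinfun_apply (Du z) (0, 2 * (Jmat *v fst v) $ j) + blinfun_apply (blinfun_apply D2 v) (?X j))) (at z)"
      by (rule has_derivative_transform_within_open[OF _ S]) (simp add: X1)
    from fun_cong[OF frechet_derivative_at[OF this], of "?X i"] have "Xd i (Xd j u) z =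
        blinfun_apply (Du z) (0, 2 * (Jmat *v fst (?X i)) $ j) + blinfun_apply (blinfun_apply D2 (?X i)) (?X j)"
      unfolding Xd_def[of i] by (rule sym)
    then show ?thesis by (simp add: hfield_def matrix_vector_mult_basis column_def)
  qed
  have J: "(Jmat :: real^('n + 'n)^('n + 'n)) $ i $ j = - (Jmat $ j $ i)" for i j
    unfolding matrix_entry using inner_Jmat[of "axis j 1" "axis i 1"] by (simp add: inner_commute)
  have hess: "hhess u z $ i $ j =
     (blinfun_apply (blinfun_apply D2 (?X i)) (?X j) + blinfun_apply (blinfun_apply D2 (?X j)) (?X i)) / 2" for i j
  proof -
    have "blinfun_apply (Du z) (0, 2 * (Jmat $ i $ j)) = - blinfun_apply (Du z) (0, 2 * (Jmat $ j $ i))"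
      using blinfun.minus_right[of "Du z" "(0, 2 * (Jmat $ j $ i))"] by (simp add: J[of i j])
    then show ?thesis by (simp add: hhess_def X2)
  qed
  have "\<xi> \<bullet> (hhess u z *v \<xi>) = (\<Sum>i\<in>UNIV. \<Sum>j\<in>UNIV. \<xi> $ i * \<xi> $ j * (hhess u z $ i $ j))"
    by (simp add: inner_vec_def matrix_vector_mult_def sum_distrib_left mult_ac)
  also have "\<dots> = (\<Sum>i\<in>UNIV. \<Sum>j\<in>UNIV. \<xi> $ i * \<xi> $ j * blinfun_apply (blinfun_apply D2 (?X i)) (?X j)) / 2
     + (\<Sum>i\<in>UNIV. \<Sum>j\<in>UNIV. \<xi> $ i * \<xi> $ j * blinfun_apply (blinfun_apply D2 (?X j)) (?X i)) / 2"
    by (simp add: hess sum.distrib sum_divide_distrib distrib_left add_divide_distrib)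
  also have "(\<Sum>i\<in>UNIV. \<Sum>j\<in>UNIV. \<xi> $ i * \<xi> $ j * blinfun_apply (blinfun_apply D2 (?X j)) (?X i)) =
      (\<Sum>i\<in>UNIV. \<Sum>j\<in>UNIV. \<xi> $ i * \<xi> $ j * blinfun_apply (blinfun_apply D2 (?X i)) (?X j))"
    by (subst sum.swap) (simp add: mult_ac)
  finally have "\<xi> \<bullet> (hhess u z *v \<xi>) =
     (\<Sum>i\<in>UNIV. \<Sum>j\<in>UNIV. \<xi> $ i * \<xi> $ j * blinfun_apply (blinfun_apply D2 (?X i)) (?X j))" by simp
  also have "\<dots> = (\<Sum>j\<in>UNIV. \<Sum>i\<in>UNIV. \<xi> $ i * \<xi> $ j * blinfun_apply (blinfun_apply D2 (?X i)) (?X j))"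
    by (rule sum.swap)
  also have "\<dots> = blinfun_apply (blinfun_apply D2 (\<Sum>i\<in>UNIV. \<xi> $ i *\<^sub>R ?X i)) (\<Sum>j\<in>UNIV. \<xi> $ j *\<^sub>R ?X j)"
    by (simp add: blinfun.sum_left blinfun.sum_right blinfun.scaleR_left blinfun.scaleR_right sum_distrib_left mult_ac)
  finally show ?thesis by (simp only: sum_hfield)
qed

text \<open>In Euclidean coordinates \<open>hline\<close> is a straight line; two applications of
  the chain rule give the form computed in \<open>inner_hhess\<close>.\<close>

lemma C2_second_difference:
  fixes u :: "'n::finite hpoint \<Rightarrow> real"
  assumes S: "open S" and u: "C2_on S u" and h0: "0 < h0"
    and inS: "\<And>s. \<bar>s\<bar> \<le> h0 \<Longrightarrow> hline z \<xi> s \<in> S"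
    and h: "h \<longlonglongrightarrow> 0" "\<And>n::nat. 0 < h n" "\<And>n. h n \<le> h0"
  shows "(\<lambda>n. (u (hline z \<xi> (h n)) + u (hline z \<xi> (- h n)) - 2 * u z) / (h n)\<^sup>2) \<longlonglongrightarrow> \<xi> \<bullet> (hhess u z *v \<xi>)"
proof -
  obtain Du :: "'n hpoint \<Rightarrow> ('n hpoint \<Rightarrow>\<^sub>L real)" and D2u :: "'n hpoint \<Rightarrow> ('n hpoint \<Rightarrow>\<^sub>L ('n hpoint \<Rightarrow>\<^sub>L real))"
    where D1: "\<And>y. y \<in> S \<Longrightarrow> (u has_derivative blinfun_apply (Du y)) (at y)"
      and D2: "\<And>y. y \<in> S \<Longrightarrow> (Du has_derivative blinfun_apply (D2u y)) (at y)"
      and cont: "continuous_on S D2u"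
    using u unfolding C2_on_def by blast
  define \<Xi> where "\<Xi> = (\<xi>, 2 * ((Jmat *v fst z) \<bullet> \<xi>))"
  have line: "hline z \<xi> s = z + s *\<^sub>R \<Xi>" for s unfolding \<Xi>_def by (rule hline_eq)
  have zS: "z \<in> S" using inS[of 0] h0 by (simp add: hmul_zero_right)
  have dl: "((\<lambda>s. z + s *\<^sub>R \<Xi>) has_derivative (\<lambda>t. t *\<^sub>R \<Xi>)) (at s)" for s
    by (auto intro!: derivative_eq_intros)
  have d1: "((\<lambda>s. u (hline z \<xi> s)) has_real_derivative blinfun_apply (Du (hline z \<xi> s)) \<Xi>) (at s)" if "\<bar>s\<bar> \<le> h0" for s
    using has_derivative_compose[OF dl D1[OF inS[OF that, unfolded line]]]
    unfolding has_field_derivative_def line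
    by (rule has_derivative_eq_rhs) (simp add: fun_eq_iff blinfun.scaleR_right)
  have d2: "((\<lambda>s. blinfun_apply (Du (hline z \<xi> s)) \<Xi>) has_real_derivative
      blinfun_apply (blinfun_apply (D2u (hline z \<xi> s)) \<Xi>) \<Xi>) (at s)" if "\<bar>s\<bar> \<le> h0" for s
  proof -
    have "((\<lambda>s. Du (z + s *\<^sub>R \<Xi>)) has_derivative (\<lambda>t. blinfun_apply (D2u (z + s *\<^sub>R \<Xi>)) (t *\<^sub>R \<Xi>))) (at s)"
      using has_derivative_compose[OF dl D2[OF inS[OF that, unfolded line]]] .
    from bounded_linear.has_derivative[OF blinfun.bounded_linear_left this, of \<Xi>]
    show ?thesis unfolding has_field_derivative_def line
      by (rule has_derivative_eq_rhs) (simp add: fun_eq_iff blinfun.scaleR_right blinfun.scaleR_left)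
  qed
  have "continuous_on {- h0<..<h0} (\<lambda>s. blinfun_apply (blinfun_apply (D2u (hline z \<xi> s)) \<Xi>) \<Xi>)"
    using inS by (intro continuous_intros continuous_on_compose2[OF cont]) auto
  then have "isCont (\<lambda>s. blinfun_apply (blinfun_apply (D2u (hline z \<xi> s)) \<Xi>) \<Xi>) 0"
    using h0 by (simp add: continuous_on_eq_continuous_at)
  from second_difference_tendsto[OF h0 d1 d2 this h]
  show ?thesis
    using inner_hhess[OF S zS D1 D2[OF zS], of \<xi>, folded \<Xi>_def] by (simp add: hmul_zero_right)
qed

section \<open>Maximum principle and critical density\<close>

context frozen
begin

text \<open>At a maximum all second differences are nonpositive. Summed over the rank-one directions
  of \<open>A\<close>, they give in the limit that the integral of the summed \<open>rker2\<close>
  is nonpositive, because \<open>super\<close> bounds the contribution of \<open>u\<close>; but that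
  integral is positive.\<close>

lemma no_interior_max:
  fixes A :: "real^('n + 'n)^('n + 'n)"
  assumes H: "compact H" "0 < emeasure lborel H"
    and G: "open G" "z \<in> G" "G \<inter> H = {}"
    and u: "open S" "G \<subseteq> S" "C2_on S u"
    and A: "transpose A = A" "\<And>x. 0 \<le> x \<bullet> (A *v x)"
      "\<And>x. \<bar>x \<bullet> (A *v x) - x \<bullet> (A0 *v x)\<bar> \<le> c0 * (x \<bullet> x)"
    and super: "trace (A ** hhess u z) \<le> 0" and c: "0 < c"
    and max: "\<And>y. y \<in> G \<Longrightarrow> c * rpot H y - u y \<le> c * rpot H z - u z"
  shows False
proof -
  obtain \<xi> :: "('n + 'n) \<Rightarrow> real^('n + 'n)" where \<xi>: "\<And>i j. A $ i $ j = (\<Sum>k\<in>UNIV. \<xi> k $ i * \<xi> k $ j)"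
    using psd_sum_rank_one[OF A(1,2)] by blast
  obtain e where e: "0 < e" "ball z e \<subseteq> G" using G openE by blast
  define \<Xi> where "\<Xi> k = (\<xi> k, 2 * ((Jmat *v fst z) \<bullet> \<xi> k))" for k
  have line: "hline z (\<xi> k) s = z + s *\<^sub>R \<Xi> k" for k s unfolding \<Xi>_def by (rule hline_eq)
  \<comment> \<open>The summand 1 makes \<open>R\<close> strictly larger than each
    \<open>norm (\<Xi> k)\<close>, so all segments with parameter up to \<open>e / R\<close> stay in
    the ball.\<close>
  define R where "R = 1 + (\<Sum>k\<in>UNIV. norm (\<Xi> k))"
  have R: "norm (\<Xi> k) < R" for k
    unfolding R_def using member_le_sum[of k UNIV "\<lambda>k. norm (\<Xi> k)"] by simp
  have R0: "0 < R" using R[of undefined] norm_ge_zero le_less_trans by blast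
  define h0 where "h0 = e / R"
  have h0: "0 < h0" using e R0 by (simp add: h0_def)
  have inG: "hline z (\<xi> k) s \<in> G" if "\<bar>s\<bar> \<le> h0" for k s
  proof -
    have "\<bar>s\<bar> * norm (\<Xi> k) \<le> h0 * norm (\<Xi> k)" using that by (intro mult_right_mono) simp_all
    also have "\<dots> < h0 * R" using R h0 by (intro mult_strict_left_mono)
    also have "\<dots> = e" using R0 by (simp add: h0_def)
    finally have "z + s *\<^sub>R \<Xi> k \<in> ball z e" by (simp add: dist_norm)
    then show ?thesis using e(2) by (auto simp: line)
  qed
  define h where "h n = h0 * inverse (real (Suc n))" for n
  have h: "h \<longlonglongrightarrow> 0" "\<And>n. 0 < h n" "\<And>n. h n \<le> h0"
  proof -
    show "h \<longlonglongrightarrow> 0" unfolding h_def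
      using tendsto_mult_right_zero[OF LIMSEQ_inverse_real_of_nat, of h0] by (simp add: mult.commute)
    show "0 < h n" for n using h0 by (simp add: h_def)
    show "h n \<le> h0" for n using h0 by (simp add: h_def field_simps)
  qed
  have z: "z \<notin> H" using G by blast
  let ?Q = "\<lambda>f k n. (f (hline z (\<xi> k) (h n)) + f (hline z (\<xi> k) (- h n)) - 2 * f z) / (h n)\<^sup>2"
  let ?I = "\<lambda>k. \<integral>\<zeta>. indicator H \<zeta> *\<^sub>R rker2 b P (hmul (hinv \<zeta>) z) (\<xi> k) \<partial>lborel"
  have V: "(\<lambda>n. ?Q (rpot H) k n) \<longlonglongrightarrow> ?I k" for k
    using inG G(3) by (intro rpot_second_difference[OF H(1) h0 _ h]) blast
  have U: "(\<lambda>n. ?Q u k n) \<longlonglongrightarrow> \<xi> k \<bullet> (hhess u z *v \<xi> k)" for k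
    using inG u(2) by (intro C2_second_difference[OF u(1,3) h0 _ h]) blast
  have lim: "(\<lambda>n. \<Sum>k\<in>UNIV. c * ?Q (rpot H) k n - ?Q u k n)
      \<longlonglongrightarrow> (\<Sum>k\<in>UNIV. c * ?I k - \<xi> k \<bullet> (hhess u z *v \<xi> k))"
    by (intro tendsto_sum tendsto_diff tendsto_mult_left V U)
  have le: "(\<Sum>k\<in>UNIV. c * ?Q (rpot H) k n - ?Q u k n) \<le> 0" for n
  proof (rule sum_nonpos)
    fix k
    have hs: "\<bar>h n\<bar> \<le> h0" "\<bar>- h n\<bar> \<le> h0" using h(2,3)[of n] by simp_all
    let ?W = "\<lambda>y. c * rpot H y - u y"
    have "c * ?Q (rpot H) k n - ?Q u k n = 
      (?W (hline z (\<xi> k) (h n)) + ?W (hline z (\<xi> k) (- h n)) - 2 * ?W z) / (h n)\<^sup>2"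
      by (simp add: diff_divide_distrib add_divide_distrib algebra_simps)
    also have "\<dots> \<le> 0"
      using add_mono[OF max[OF inG[OF hs(1), of k]] max[OF inG[OF hs(2), of k]]]
      by (intro divide_nonpos_nonneg zero_le_power2) (simp only: mult_2 diff_le_0_iff_le)
    finally show "c * ?Q (rpot H) k n - ?Q u k n \<le> 0" .
  qed
  have "(\<Sum>k\<in>UNIV. c * ?I k - \<xi> k \<bullet> (hhess u z *v \<xi> k)) \<le> 0"
    by (rule LIMSEQ_le_const2[OF lim]) (use le in blast)
  then have "c * (\<Sum>k\<in>UNIV. ?I k) \<le> trace (A ** hhess u z)"
    by (simp add: sum_rank_one_trace[OF \<xi>] sum_subtractf sum_distrib_left)
  moreover have "(\<Sum>k\<in>UNIV. ?I k) =
     (\<integral>\<zeta>. indicator H \<zeta> *\<^sub>R (\<Sum>k\<in>UNIV. rker2 b P (hmul (hinv \<zeta>) z) (\<xi> k)) \<partial>lborel)"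
    unfolding scaleR_sum_right
    by (intro Bochner_Integration.integral_sum[symmetric] borel_integrable_compact H continuous_on_pole z)
  ultimately have "c * (\<integral>\<zeta>. indicator H \<zeta> *\<^sub>R (\<Sum>k\<in>UNIV. rker2 b P (hmul (hinv \<zeta>) z) (\<xi> k)) \<partial>lborel) \<le> 0"
    using super by simp
  moreover have "0 < c * (\<integral>\<zeta>. indicator H \<zeta> *\<^sub>R (\<Sum>k\<in>UNIV. rker2 b P (hmul (hinv \<zeta>) z) (\<xi> k)) \<partial>lborel)"
    by (intro mult_pos_pos c integral_sum_rker2_pos[OF \<xi> A(3) H(1) z H(2)])
  ultimately show False by linarith
qed

text \<open>The contradiction arises at a maximum point of \<open>W = 2V/M - u\<close> on
  \<open>G\<close>, the set where \<open>u < 1\<close>: \<open>W\<close> exceeds 1 at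
  \<open>z1\<close>, is at most 1 outside \<open>C\<close>, and has limits at most 1 where
  \<open>u\<close> tends to 1.\<close>

lemma critical_density:
  fixes A :: "'n hpoint \<Rightarrow> real^('n + 'n)^('n + 'n)"
  assumes r: "0 < r" and \<eta>: "3 \<le> \<eta>"
    and u: "C2_on (hball z0 (\<eta> * r)) u" "\<And>z. z \<in> hball z0 (\<eta> * r) \<Longrightarrow> 0 \<le> u z"
    and A: "\<And>z. z \<in> hball z0 (\<eta> * r) \<Longrightarrow> transpose (A z) = A z"
      "\<And>z x. z \<in> hball z0 (\<eta> * r) \<Longrightarrow> 0 \<le> x \<bullet> (A z *v x)"
      "\<And>z x. z \<in> hball z0 (\<eta> * r) \<Longrightarrow> \<bar>x \<bullet> (A z *v x) - x \<bullet> (A0 *v x)\<bar> \<le> c0 * (x \<bullet> x)"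
    and super: "\<And>z. z \<in> hball z0 (\<eta> * r) \<Longrightarrow> LA A u z \<le> 0"
    and z1: "z1 \<in> hball z0 (r / 2)" "u z1 < 1 / 2"
  shows "ennreal ((1/8) ^ hexp TYPE('n) / 8) * emeasure lborel (fball P (sqrt lam * r / 2))
    < emeasure lborel {z \<in> hball z0 r. u z < 1}"
proof (rule ccontr)
  let ?E = "{z \<in> hball z0 r. u z < 1}"
  define S where "S = hball z0 (\<eta> * r)"
  \<comment> \<open>With this radius the ball of \<open>hform P\<close> around \<open>z1\<close>
    lies within distance \<open>r/2\<close> of \<open>z1\<close>, hence in
    \<open>hball z0 r\<close>.\<close>
  define s where "s = sqrt lam * r / 2"
  define H where "H = {\<zeta> \<in> fnbhd P s z1. 1 \<le> u \<zeta>}"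
  \<comment> \<open>A compact subset of \<open>S\<close>, since \<open>\<eta> \<ge> 3\<close>; a
    point outside it has distance at least \<open>r\<close> from every pole in
    \<open>H\<close>.\<close>
  define C where "C = {w. hdist z0 w \<le> 2 * r}"
  assume "\<not> ?thesis"
  then have small: "emeasure lborel ?E \<le> ennreal ((1/8) ^ hexp TYPE('n) / 8) * emeasure lborel (fball P s)"
    by (simp add: s_def)
  have s: "0 < s" using r lam_pos by (simp add: s_def)
  have "3 * r \<le> \<eta> * r" using r \<eta> by simp
  then have rr: "r < \<eta> * r" "2 * r < \<eta> * r" using r by linarith+
  have rS: "hball z0 r \<subseteq> S" and CS: "C \<subseteq> S"
    unfolding S_def C_def hball_def by (auto intro: less_trans[OF _ rr(1)] le_less_trans[OF _ rr(2)])
  have openS: "open S" by (simp add: S_def open_hball)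
  have u_cont: "continuous_on S u"
    using u(1) unfolding C2_on_def S_def[symmetric]
    by (metis continuous_at_imp_continuous_on has_derivative_continuous)
  have near: "hdist z1 \<zeta> \<le> r / 2" if "\<zeta> \<in> fnbhd P s z1" for \<zeta>
  proof -
    have "sqrt lam * hdist \<zeta> z1 \<le> s"
      using that fball_gauge[OF _ s] by (simp add: fnbhd_def hdist_def)
    also have "s = sqrt lam * (r / 2)" by (simp add: s_def)
    finally show ?thesis using lam_pos by (simp add: hdist_commute)
  qed
  have in_r: "fnbhd P s z1 \<subseteq> hball z0 r"
  proof
    fix \<zeta> assume "\<zeta> \<in> fnbhd P s z1"
    then show "\<zeta> \<in> hball z0 r"
      using near[of \<zeta>] hdist_triangle[of z0 \<zeta> z1] z1(1) by (simp add: hball_def)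
  qed
  have "closed (fnbhd P s z1)"
    unfolding fnbhd_def fball_def mem_Collect_eq by (intro closed_Collect_le continuous_intros)
  moreover have "fnbhd P s z1 \<subseteq> {w. hdist z1 w \<le> r / 2}" using near by blast
  ultimately have cptN: "compact (fnbhd P s z1)"
    using compact_hdist_le by (metis compact_Int_closed inf.absorb_iff2)
  have cptH: "compact H"
  proof -
    have "closed H" unfolding H_def
      using continuous_on_subset[OF u_cont, of "fnbhd P s z1"] in_r rS cptN
      by (intro continuous_on_closed_Collect_le) (auto simp: compact_imp_closed)
    then show ?thesis using cptN unfolding H_def by (metis (no_types, lifting) compact_Int_closed inf.absorb_iff2 mem_Collect_eq subsetI)
  qed
  have H_meas [measurable]: "H \<in> sets borel" using cptH by (simp add: compact_imp_closed)
  have HN: "H \<subseteq> fnbhd P s z1" by (auto simp: H_def)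
  define G where "G = {y \<in> S. u y < 1}"
  have openG: "open G"
  proof -
    have "G = S \<inter> u -` {..<1}" by (auto simp: G_def)
    then show ?thesis using continuous_open_preimage[OF u_cont openS, of "{..<1}"] by simp
  qed
  have GH: "G \<inter> H = {}" by (auto simp: G_def H_def)
  have z1G: "z1 \<in> G"
  proof -
    have "z1 \<in> hball z0 r" using z1(1) r by (simp add: hball_def)
    then show ?thesis using rS z1(2) by (auto simp: G_def)
  qed
  obtain M where M: "fmass P s = ennreal M" "0 < M"
    using fmass_finite[OF s] fmass_pos[OF s] by (cases "fmass P s") auto
  have rpot0: "0 \<le> rpot H y" for y
    unfolding rpot_def by (intro Bochner_Integration.integral_nonneg) (simp add: rker_def)
  have V_le: "rpot H y \<le> M" if "y \<in> G" for y
    using fpot_le_fmass[OF H_meas s HN, of y] GH that M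
    by (subst (asm) fpot_eq_rpot[OF cptH]) auto
  \<comment> \<open>Distance at least \<open>r\<close> from the poles amounts to distance at least
    \<open>sqrt lam * r = 2 * s\<close> in the gauge of \<open>hform P\<close>.\<close>
  have V_far: "2 * rpot H y \<le> M" if "y \<in> G" "y \<notin> C" for y
  proof -
    have "2 * fpot P H y \<le> fmass P s"
    proof (rule fpot_le_half_fmass[OF H_meas s HN])
      fix \<zeta> assume "\<zeta> \<in> H"
      then have "hdist z0 \<zeta> < r" using HN in_r by (auto simp: hball_def)
      then have "r \<le> hdist \<zeta> y" using that(2) hdist_triangle[of z0 y \<zeta>] by (simp add: C_def)
      then have "r ^ 4 \<le> hdist \<zeta> y ^ 4" using r by (intro power_mono) simp_all
      then have "lam\<^sup>2 * r ^ 4 \<le> lam\<^sup>2 * hgauge (hmul (hinv \<zeta>) y) ^ 4" unfolding hdist_def by (intro mult_left_mono) simp_all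
      also have "\<dots> \<le> hform P (hmul (hinv \<zeta>) y)" by (rule hform_ge)
      also have "lam\<^sup>2 * r ^ 4 = (2 * s) ^ 4" using lam_pos by (simp add: s_def power_mult_distrib real_sqrt_pow4)
      finally show "(2 * s) ^ 4 \<le> hform P (hmul (hinv \<zeta>) y)" .
    qed
    moreover have "y \<notin> H" using GH that by blast
    ultimately have "ennreal (2 * rpot H y) \<le> ennreal M"
      using M rpot0[of y] by (simp add: fpot_eq_rpot[OF cptH] ennreal_mult)
    then show ?thesis using M by simp
  qed
  have V_z1: "3 / 4 * M \<le> rpot H z1"
  proof -
    have "fnbhd P s z1 - H \<subseteq> ?E" using in_r by (auto simp: H_def)
    moreover have "?E \<in> sets lborel"
    proof -
      have "?E = G \<inter> hball z0 r" using rS by (auto simp: G_def)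
      then show ?thesis using openG by (simp add: open_hball open_Int)
    qed
    ultimately have "emeasure lborel (fnbhd P s z1 - H) \<le> emeasure lborel ?E" by (rule emeasure_mono)
    then have "fmass P s \<le> fpot P H z1 + ennreal (1/4) * fmass P s"
      using small by (intro fmass_le_fpot[OF H_meas s]) (rule order.trans)
    moreover have "z1 \<notin> H" using GH z1G by blast
    ultimately have "ennreal M \<le> ennreal (rpot H z1) + ennreal (1/4) * ennreal M"
      unfolding M using fpot_eq_rpot[OF cptH] by simp
    also have "\<dots> = ennreal (rpot H z1 + 1/4 * M)"
      using M(2) rpot0[of z1] ennreal_mult[of "1/4" M] ennreal_plus[of "rpot H z1" "1/4 * M"] by simp
    finally show ?thesis using rpot0[of z1] M by (subst (asm) ennreal_le_iff) auto
  qed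
  have Hpos: "0 < emeasure lborel H"
  proof (rule ccontr)
    assume "\<not> ?thesis"
    then have "H \<in> null_sets lborel" by (auto intro: null_setsI)
    then have "fpot P H z1 = 0" unfolding fpot_def by (rule nn_integral_null_set)
    moreover have "z1 \<notin> H" using GH z1G by blast
    ultimately have "rpot H z1 \<le> 0" by (simp add: fpot_eq_rpot[OF cptH] ennreal_eq_0_iff)
    then show False using V_z1 M(2) by linarith
  qed
  define W where "W y = 2 / M * rpot H y - u y" for y
  have u0: "0 \<le> u y" if "y \<in> G" for y using that u(2) by (auto simp: G_def S_def)
  have W_le: "W y \<le> 2 - u y" if "y \<in> G" for y
    using V_le[OF that] M(2) by (simp add: W_def field_simps)
  have W_far: "W y \<le> 1" if "y \<in> G" "y \<notin> C" for y
  proof -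
    have "2 / M * rpot H y \<le> 1" using V_far[OF that] M(2) by (simp add: field_simps)
    then show ?thesis using u0[OF that(1)] by (simp add: W_def)
  qed
  have W_z1: "1 < W z1"
  proof -
    have "3 / 2 \<le> 2 / M * rpot H z1" using V_z1 M(2) by (simp add: field_simps)
    then show ?thesis using z1(2) by (simp add: W_def)
  qed
  define L where "L = (SUP y\<in>G. W y)"
  have "bdd_above (W ` G)"
  proof (rule bdd_aboveI2)
    fix y assume "y \<in> G"
    then show "W y \<le> 2" using W_le[of y] u0[of y] by linarith
  qed
  then have W_le_L: "W y \<le> L" if "y \<in> G" for y unfolding L_def using that by (intro cSUP_upper)
  have L: "1 < L" using W_z1 W_le_L[OF z1G] by linarith
  \<comment> \<open>The tolerance is a fraction of \<open>L - 1\<close>, so every term of the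
    maximising sequence has \<open>W\<close> above 1 and therefore lies in \<open>C\<close>.\<close>
  have "\<exists>y\<in>G. L - (L - 1) * inverse (real (Suc n)) < W y" for n
  proof -
    have "L - (L - 1) * inverse (real (Suc n)) < L" using L by simp
    then show ?thesis
      using z1G \<open>bdd_above (W ` G)\<close> unfolding L_def by (subst (asm) less_cSUP_iff) auto
  qed
  then obtain y where y: "\<And>n. y n \<in> G" "\<And>n. L - (L - 1) * inverse (real (Suc n)) < W (y n)" by metis
  have yC: "y n \<in> C" for n
  proof (rule ccontr)
    assume "y n \<notin> C"
    then have "W (y n) \<le> 1" using W_far y(1) by blast
    also have "1 = L - (L - 1) * 1" by simp
    also have "\<dots> \<le> L - (L - 1) * inverse (real (Suc n))"
      using L by (intro diff_left_mono mult_left_mono) (simp_all add: field_simps)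
    finally show False using y(2)[of n] by simp
  qed
  have Wy: "(\<lambda>n. W (y n)) \<longlonglongrightarrow> L"
  proof (rule tendsto_sandwich)
    have "(\<lambda>n. L - (L - 1) * inverse (real (Suc n))) \<longlonglongrightarrow> L - (L - 1) * 0"
      by (intro tendsto_intros LIMSEQ_inverse_real_of_nat)
    then show "(\<lambda>n. L - (L - 1) * inverse (real (Suc n))) \<longlonglongrightarrow> L" by simp
    show "\<forall>\<^sub>F n in sequentially. L - (L - 1) * inverse (real (Suc n)) \<le> W (y n)"
      using y(2) by (intro always_eventually allI less_imp_le)
    show "\<forall>\<^sub>F n in sequentially. W (y n) \<le> L"
      using W_le_L y(1) by (intro always_eventually allI) blast
  qed (rule tendsto_const)
  have "compact C" unfolding C_def by (rule compact_hdist_le)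
  then obtain z q where z: "z \<in> C" "strict_mono q" "(y \<circ> q) \<longlonglongrightarrow> z"
    using yC unfolding compact_def by metis
  have zS: "z \<in> S" using z(1) CS by blast
  have Wyq: "(\<lambda>n. W (y (q n))) \<longlonglongrightarrow> L"
    using LIMSEQ_subseq_LIMSEQ[OF Wy z(2)] by (simp add: o_def)
  have zlim: "(\<lambda>n. y (q n)) \<longlonglongrightarrow> z" using z(3) by (simp add: o_def)
  have yS: "y n \<in> S" for n using yC CS by blast
  have uq: "(\<lambda>n. u (y (q n))) \<longlonglongrightarrow> u z"
    by (rule continuous_on_tendsto_compose[OF u_cont zlim zS]) (simp add: yS)
  have "u z \<le> 1"
    by (rule LIMSEQ_le_const2[OF uq]) (use y(1) in \<open>auto simp: G_def less_imp_le\<close>)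
  \<comment> \<open>Together with \<open>L > 1\<close> this sharpens \<open>u z \<le> 1\<close> to
    \<open>u z < 1\<close>, which keeps the limit inside \<open>G\<close> and away from the
    poles.\<close>
  moreover have "L \<le> 2 - u z"
    by (rule LIMSEQ_le[OF Wyq tendsto_diff[OF tendsto_const uq]]) (use W_le y(1) in auto)
  ultimately have zG: "z \<in> G" using L zS by (auto simp: G_def)
  then have zH: "z \<notin> H" using GH by blast
  have "(\<lambda>n. W (y (q n))) \<longlonglongrightarrow> W z"
    unfolding W_def by (intro tendsto_intros rpot_tendsto[OF cptH zH zlim] uq)
  then have "W z = L" using Wyq by (rule LIMSEQ_unique)
  then have max: "2 / M * rpot H y - u y \<le> 2 / M * rpot H z - u z" if "y \<in> G" for y
    using W_le_L[OF that] by (simp add: W_def)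
  show False
  proof (rule no_interior_max[OF cptH Hpos openG zG GH openS _ _ _ _ _ _ _ max])
    show "G \<subseteq> S" by (auto simp: G_def)
    show "C2_on S u" using u(1) by (simp add: S_def)
    show "trace (A z ** hhess u z) \<le> 0" using super[of z] zS by (simp add: LA_def S_def)
  qed (use A zS M in \<open>auto simp: S_def\<close>)
qed

end

section \<open>Volumes of balls and the choice of constants\<close>

lemma hgauge_hdil: "0 < c \<Longrightarrow> hgauge (hdil c w) = c * hgauge w"
  by (rule power_eq_imp_eq_base[of _ 4])
     (simp_all add: hgauge_nonneg hgauge_pow4 power_mult_distrib hdil_def distrib_left flip: power_mult)

lemma emeasure_hball:
  fixes z :: "'n::finite hpoint"
  shows "emeasure lborel (hball z r) = emeasure lborel {w::'n hpoint. hgauge w < r}"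
proof -
  have "hball z r = {\<zeta>. hmul (hinv \<zeta>) z \<in> {w. hgauge w < r}}"
    unfolding hball_def by (subst hdist_commute) (simp add: hdist_def)
  moreover have "open {w::'n hpoint. hgauge w < r}"
    by (intro open_Collect_less continuous_intros)
  ultimately show ?thesis using emeasure_hmul_hinv[of "{w::'n hpoint. hgauge w < r}" z] by simp
qed

lemma emeasure_hball_scale:
  fixes z :: "'n::finite hpoint"
  assumes c: "0 < c"
  shows "emeasure lborel (hball z (c * r)) = ennreal (c ^ (hexp TYPE('n) + 1)) * emeasure lborel (hball z r)"
proof -
  have "open {w::'n hpoint. hgauge w < c * r}"
    by (intro open_Collect_less continuous_intros)
  then have "emeasure lborel {w::'n hpoint. hgauge w < c * r} =
     ennreal (c ^ (2 * CARD('n) + 2)) * emeasure lborel {w. hdil c w \<in> {w::'n hpoint. hgauge w < c * r}}"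
    using c by (intro emeasure_hdil) simp_all
  then show ?thesis using c by (simp add: emeasure_hball hgauge_hdil hexp_def)
qed

lemma (in hform_bounds) emeasure_fball_ge:
  fixes z :: "'n hpoint"
  shows "emeasure lborel (hball z (s / sqrt Lam)) \<le> emeasure lborel (fball P s)"
  unfolding emeasure_hball
proof (rule emeasure_mono)
  show "{w. hgauge w < s / sqrt Lam} \<subseteq> fball P s"
    using Lam_ge by (auto intro!: gauge_fball simp: field_simps)
qed simp

lemma inner_matrix_diff_le:
  fixes A B :: "real^'n::finite^'n"
  assumes "onorm (\<lambda>v. (A - B) *v v) \<le> c"
  shows "\<bar>x \<bullet> (A *v x) - x \<bullet> (B *v x)\<bar> \<le> c * (x \<bullet> x)"
proof -
  have "x \<bullet> (A *v x) - x \<bullet> (B *v x) = x \<bullet> ((A - B) *v x)"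
    by (simp add: matrix_vector_mult_diff_rdistrib inner_diff_right)
  also have "\<bar>\<dots>\<bar> \<le> norm x * norm ((A - B) *v x)" by (rule Cauchy_Schwarz_ineq2)
  also have "\<dots> \<le> norm x * (c * norm x)"
  proof (intro mult_left_mono)
    have "norm ((A - B) *v x) \<le> onorm (\<lambda>v. (A - B) *v v) * norm x"
      by (rule onorm[OF matrix_vector_mul_bounded_linear])
    also have "\<dots> \<le> c * norm x" by (intro mult_right_mono assms) simp
    finally show "norm ((A - B) *v x) \<le> c * norm x" .
  qed simp
  finally show ?thesis by (simp add: power2_norm_eq_inner[symmetric] power2_eq_square mult_ac)
qed

lemma matrix_mul_matrix_inv:
  fixes A :: "real^'n::finite^'n"
  assumes "invertible A" shows "A ** matrix_inv A = mat 1"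
  using assms unfolding invertible_def matrix_inv_def by (rule someI2_ex) simp

theorem theorem4p1:
  fixes \<delta> lam Lam :: real
  assumes "0 < \<delta>" "\<delta> < 1/2" "0 < lam" "lam \<le> 1" "1 \<le> Lam"
  shows "\<exists>\<epsilon>. 0 < \<epsilon> \<and> \<epsilon> < 1 \<and>
    (\<forall>\<omega>. modulus \<omega> \<longrightarrow>
      (\<exists>\<epsilon>0. 0 < \<epsilon>0 \<and> \<epsilon>0 < 1 \<and>
        (\<forall>(\<Omega> :: 'n::finite hpoint set) z0 r A u.
           open \<Omega> \<longrightarrow> z0 \<in> \<Omega> \<longrightarrow> 0 < r \<longrightarrow> r \<le> \<epsilon>0 \<longrightarrow>
           hball z0 ((2 * sqrt (Lam / lam) + 1) * r) \<subseteq> \<Omega> \<longrightarrow>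
           symplectic_on \<Omega> A \<longrightarrow> Mclass lam Lam \<Omega> A \<longrightarrow> Cclass \<Omega> \<omega> A \<longrightarrow>
           C2_on (hball z0 ((2 * sqrt (Lam / lam) + 1) * r)) u \<longrightarrow>
           (\<forall>z\<in>hball z0 ((2 * sqrt (Lam / lam) + 1) * r). 0 \<le> u z) \<longrightarrow>
           (\<forall>z\<in>hball z0 ((2 * sqrt (Lam / lam) + 1) * r). LA A u z \<le> 0) \<longrightarrow>
           (INF z\<in>hball z0 (r / 2). u z) < 1/2 \<longrightarrow>
           measure lebesgue {z \<in> hball z0 r. u z < 1} \<ge> \<epsilon> * measure lebesgue (hball z0 r))))"
proof -
  define K where "K = hexp TYPE('n)"
  define b where "b = real K / 4"
  \<comment> \<open>\<open>D\<close> is the factor of \<open>c0\<close> in the locale assumption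
    \<open>c0_eq\<close>, which determines \<open>c0 = 2 / D\<close>.\<close>
  define D where "D = 16 * (b + 2) / lam + 8 * real CARD('n) * Lam"
  define c0 where "c0 = 2 / D"
  define \<eta> where "\<eta> = 2 * sqrt (Lam / lam) + 1"
  \<comment> \<open>The ball of \<open>hform P\<close> of radius \<open>sqrt lam * r / 2\<close> has
    at least the volume of a gauge ball of radius \<open>c * r\<close>.\<close>
  define c where "c = sqrt lam / (2 * sqrt Lam)"
  \<comment> \<open>The constant of \<open>critical_density\<close> times the volume ratio
    \<open>c^Q\<close>; it is fixed before \<open>\<omega>\<close> is introduced.\<close>
  define \<epsilon> where "\<epsilon> = (1/8) ^ K / 8 * c ^ (K + 1)"
  have D: "0 < D" unfolding D_def b_def using assms by (intro add_pos_nonneg) simp_all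
  then have c0: "0 < c0" by (simp add: c0_def)
  have c0_D: "c0 * (16 * (b + 2) / lam + 8 * real CARD('n) * Lam) = 2"
    unfolding c0_def D_def[symmetric] using D by simp
  have "1 \<le> sqrt (Lam / lam)" using assms by (simp add: field_simps)
  then have \<eta>: "3 \<le> \<eta>" by (simp add: \<eta>_def)
  have c: "0 < c" "c \<le> 1"
  proof -
    have "sqrt lam \<le> sqrt Lam" using assms by simp
    moreover have "0 \<le> sqrt Lam" using assms by simp
    ultimately have "sqrt lam \<le> 2 * sqrt Lam" by linarith
    then show "0 < c" "c \<le> 1" using assms by (simp_all add: c_def)
  qed
  have \<epsilon>0: "0 < \<epsilon>" using c by (simp add: \<epsilon>_def)
  have "(1/8) ^ K / 8 * c ^ (K + 1) \<le> (1/8) ^ K / 8 * (1::real)"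
    using c by (intro mult_left_mono power_le_one) simp_all
  also have "\<dots> < 1" using power_le_one[of "1/8::real" K] by simp
  finally have \<epsilon>1: "\<epsilon> < 1" by (simp add: \<epsilon>_def)
  show ?thesis
  proof (rule exI[of _ \<epsilon>], intro conjI allI impI \<epsilon>0 \<epsilon>1)
    fix \<omega> assume "modulus \<omega>"
    then have "(\<omega> \<longlongrightarrow> 0) (at_right 0)" by (simp add: modulus_def)
    then have "\<forall>\<^sub>F s in at_right 0. \<omega> s < c0" using c0 by (rule order_tendstoD)
    then obtain d where d: "0 < d" "\<And>s. 0 < s \<Longrightarrow> s < d \<Longrightarrow> \<omega> s < c0"
      by (auto simp: eventually_at_right_field)
    \<comment> \<open>This ensures \<open>\<eta> * r < min d 1\<close>, the factor 2 giving
      strictness, so that \<open>\<omega>\<close> may be evaluated at \<open>\<eta> * r\<close> and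
      is below \<open>c0\<close> there.\<close>
    define \<epsilon>0 where "\<epsilon>0 = min d 1 / (2 * \<eta>)"
    have \<epsilon>0: "0 < \<epsilon>0" "\<epsilon>0 < 1" using d \<eta> by (simp_all add: \<epsilon>0_def field_simps min_def)
    show "\<exists>\<epsilon>0. 0 < \<epsilon>0 \<and> \<epsilon>0 < 1 \<and>
        (\<forall>(\<Omega> :: 'n::finite hpoint set) z0 r A u.
           open \<Omega> \<longrightarrow> z0 \<in> \<Omega> \<longrightarrow> 0 < r \<longrightarrow> r \<le> \<epsilon>0 \<longrightarrow>
           hball z0 ((2 * sqrt (Lam / lam) + 1) * r) \<subseteq> \<Omega> \<longrightarrow>
           symplectic_on \<Omega> A \<longrightarrow> Mclass lam Lam \<Omega> A \<longrightarrow> Cclass \<Omega> \<omega> A \<longrightarrow>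
           C2_on (hball z0 ((2 * sqrt (Lam / lam) + 1) * r)) u \<longrightarrow>
           (\<forall>z\<in>hball z0 ((2 * sqrt (Lam / lam) + 1) * r). 0 \<le> u z) \<longrightarrow>
           (\<forall>z\<in>hball z0 ((2 * sqrt (Lam / lam) + 1) * r). LA A u z \<le> 0) \<longrightarrow>
           (INF z\<in>hball z0 (r / 2). u z) < 1/2 \<longrightarrow>
           measure lebesgue {z \<in> hball z0 r. u z < 1} \<ge> \<epsilon> * measure lebesgue (hball z0 r))"
      unfolding \<eta>_def[symmetric]
    proof (intro exI[of _ \<epsilon>0] conjI allI impI \<epsilon>0)
      fix \<Omega> :: "'n hpoint set" and z0 r A u
      assume z0: "z0 \<in> \<Omega>" and r: "0 < r" "r \<le> \<epsilon>0" and sub: "hball z0 (\<eta> * r) \<subseteq> \<Omega>"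
        and sympl: "symplectic_on \<Omega> A" and M: "Mclass lam Lam \<Omega> A" and C: "Cclass \<Omega> \<omega> A"
        and u: "C2_on (hball z0 (\<eta> * r)) u" "\<forall>z\<in>hball z0 (\<eta> * r). 0 \<le> u z"
          "\<forall>z\<in>hball z0 (\<eta> * r). LA A u z \<le> 0"
        and inf: "(INF z\<in>hball z0 (r / 2). u z) < 1 / 2"
      have A: "transpose (A z) = A z" "det (A z) = 1" "lam * (x \<bullet> x) \<le> x \<bullet> (A z *v x)"
        "x \<bullet> (A z *v x) \<le> Lam * (x \<bullet> x)" if "z \<in> \<Omega>" for z x
        using M that unfolding Mclass_def by blast+
      \<comment> \<open>Determinant 1 makes \<open>matrix_inv\<close> a genuine inverse, which turns
        the symplectic condition into the identity assumed in \<open>frozen\<close>.\<close>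
      have "A z0 ** matrix_inv (A z0) = mat 1"
        using A(2)[OF z0] by (intro matrix_mul_matrix_inv) (simp add: invertible_det_nz)
      then have inv: "A z0 ** (transpose Jmat ** A z0 ** Jmat) = mat 1"
        using sympl z0 by (simp add: symplectic_on_def)
      interpret frozen "A z0" lam Lam b c0
        by unfold_locales (rule assms A[OF z0] c0 c0_D inv | simp only: b_def K_def)+
      let ?E = "{z \<in> hball z0 r. u z < 1}"
      have "\<eta> * r \<le> \<eta> * \<epsilon>0" using r \<eta> by (intro mult_left_mono) simp_all
      also have "\<dots> = min d 1 / 2" using \<eta> by (simp add: \<epsilon>0_def)
      also have "\<dots> < min d 1"
      proof -
        have "0 < min d 1" using d(1) by simp
        then show ?thesis by linarith
      qed
      finally have er: "0 < \<eta> * r" "\<eta> * r < d" "\<eta> * r < 1" using r \<eta> by simp_all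
      have near: "\<bar>x \<bullet> (A z *v x) - x \<bullet> (A z0 *v x)\<bar> \<le> c0 * (x \<bullet> x)" if "z \<in> hball z0 (\<eta> * r)" for z x
      proof (rule inner_matrix_diff_le)
        have "onorm (\<lambda>v. (A z - A z0) *v v) \<le> \<omega> (\<eta> * r)"
          using C z0 er that sub unfolding Cclass_def by blast
        then show "onorm (\<lambda>v. (A z - A z0) *v v) \<le> c0" using d(2)[OF er(1,2)] by linarith
      qed
      have psd: "0 \<le> x \<bullet> (A z *v x)" if "z \<in> \<Omega>" for z x
        using A(3)[OF that, of x] assms(3) by (smt (verit) inner_ge_zero mult_nonneg_nonneg)
      \<comment> \<open>The ball must be nonempty for a point to be extracted from the bound on the
        infimum.\<close>
      have "z0 \<in> hball z0 (r / 2)"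
        using r hgauge_eq_0_iff[of "0::'n hpoint"] hmul_hinv_eq_0[of z0 z0] by (simp add: hball_def hdist_def)
      then have ne: "u ` hball z0 (r / 2) \<noteq> {}" by blast
      obtain z1 where z1: "z1 \<in> hball z0 (r / 2)" "u z1 < 1 / 2"
        using cInf_lessD[OF ne inf] by blast
      have dens: "ennreal ((1/8) ^ K / 8) * emeasure lborel (fball P (sqrt lam * r / 2)) < emeasure lborel ?E"
        unfolding K_def
        by (rule critical_density[OF r(1) \<eta> u(1) _ _ _ near _ z1]) (use u A(1) psd sub in auto)
      have "r \<le> \<eta> * r" using \<eta> r by simp
      then have rS: "hball z0 r \<subseteq> hball z0 (\<eta> * r)" by (auto simp: hball_def)
      have "continuous_on (hball z0 r) u"
        using u(1) rS unfolding C2_on_def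
        by (metis continuous_at_imp_continuous_on has_derivative_continuous subsetD)
      then have "open (hball z0 r \<inter> u -` {..<1})"
        by (intro continuous_open_preimage open_hball open_lessThan)
      moreover have "hball z0 r \<inter> u -` {..<1} = ?E" by auto
      ultimately have E: "?E \<in> sets lborel" by simp
      have B: "hball z0 r \<in> sets lborel" by (simp add: open_hball)
      have "bounded (hball z0 r)"
        by (rule bounded_subset[OF compact_imp_bounded[OF compact_hdist_le[of z0 r]]]) (auto simp: hball_def)
      then have Bfin: "emeasure lborel (hball z0 r) < \<infinity>" by (rule emeasure_bounded_finite)
      have "emeasure lborel ?E \<le> emeasure lborel (hball z0 r)" by (intro emeasure_mono B) auto
      then have Efin: "emeasure lborel ?E < \<infinity>" using Bfin by simp
      have "sqrt lam * r / 2 / sqrt Lam = c * r" by (simp add: c_def)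
      then have ge: "ennreal (c ^ (K + 1)) * emeasure lborel (hball z0 r) \<le> emeasure lborel (fball P (sqrt lam * r / 2))"
        using emeasure_fball_ge[of z0 "sqrt lam * r / 2"] emeasure_hball_scale[OF c(1), of z0 r] by (simp add: K_def)
      have "ennreal \<epsilon> * emeasure lborel (hball z0 r) =
         ennreal ((1/8) ^ K / 8) * (ennreal (c ^ (K + 1)) * emeasure lborel (hball z0 r))"
        unfolding \<epsilon>_def using c by (intro ennreal_mult_assoc[symmetric]) simp_all
      also have "\<dots> \<le> ennreal ((1/8) ^ K / 8) * emeasure lborel (fball P (sqrt lam * r / 2))"
        by (intro mult_left_mono ge) simp
      also have "\<dots> < emeasure lborel ?E" by (rule dens)
      \<comment> \<open>Both measures are finite, so the inequality passes to real numbers; both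
        sets are open, so \<open>lborel\<close> and \<open>lebesgue\<close> agree on them.\<close>
      finally have "ennreal \<epsilon> * ennreal (measure lborel (hball z0 r)) \<le> ennreal (measure lborel ?E)"
        using Bfin Efin by (simp add: emeasure_eq_ennreal_measure less_top)
      then have "\<epsilon> * measure lborel (hball z0 r) \<le> measure lborel ?E"
        using \<open>0 < \<epsilon>\<close> by (simp add: ennreal_mult[symmetric])
      then show "\<epsilon> * measure lebesgue (hball z0 r) \<le> measure lebesgue ?E"
        using E B by (simp only: measure_completion)
    qed
  qed
qed

end
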